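(* Let $F:\mathscr{D}(F)\subset L^2(\Omega)\to H$, $y\in H$, $\bar u\in\mathcal{S}(y)\cap\operatorname{dom}h$ and $\eta,\rho>0$ satisfy the assumption (B) of the context, with $h(u)=\frac12\|u\|_{L^2(\Omega)}^2+|u|_{BV(\Omega)}$, so that $h(\bar u)<\infty$. Let $0<\gamma<\min\{\frac1\eta,\frac\rho2\}$ and let $0<\alpha_k<\bar\alpha$ for all $k\in\mathbb{N}_0$. Assume that the starting values $u_0\in\mathscr{D}(F)\cap\operatorname{dom}h$ and $\xi_0\in\partial h(u_0)$, $u_0,\xi_0\in L^2(\Omega)$, satisfy $D_h^{\xi_0}(\bar u,u_0)<\frac{\gamma^2}{8}$. Let $(u_k)$ be the sequence of iterates generated with exact data $y$ by the iterated Tikhonov method $$u_{k+1}\in\operatorname{argmin}_{u\in\mathscr{D}(F)}\left\{\tfrac12\|F(u)-y\|^2+\alpha_kD_h^{\xi_k}(u,u_k)\right\},\qquad \xi_{k+1}=\xi_k-\tfrac1{\alpha_k}F'(u_{k+1})^*\left(F(u_{k+1})-y\right).$$ Then $(u_k)$ has a subsequence converging to some $u\in\mathcal{S}(y)$ in the weak-$*$ topology of $BV(\Omega)$. Moreover, if $\mathcal{S}(y)\cap\overline{B_\rho(\bar u)}=\{\bar u\}$, then $u_k\overset{*}{\rightharpoonup}\bar u$ in $BV(\Omega)$.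
   Context: $\Omega\subset\mathbb{R}^n$ is a bounded Lipschitz domain, $H$ is a Hilbert space, $F:\mathscr{D}(F)\subset L^2(\Omega)\to H$ is a nonlinear Fréchet differentiable operator with closed and convex domain $\mathscr{D}(F)$, and $\mathcal{S}(y)=\{u\in\mathscr{D}(F): F(u)=y\}$. $|u|_{BV(\Omega)}$ is the total variation seminorm of $u$ ($+\infty$ if $u\notin BV(\Omega)$), and $\operatorname{dom}h=\{u:h(u)<\infty\}$. Subgradients of $h$ are elements of $L^2(\Omega)$ (identified with its dual), and for $\xi\in\partial h(u)$ the Bregman distance is $D_h^\xi(v,u)=h(v)-h(u)-\langle\xi,v-u\rangle$; in the iteration $\xi_k\in\partial h(u_k)$. $F'(u)^*$ denotes the adjoint of $F'(u)$. Assumption (B): $F$ is weakly sequentially closed, $F'(\cdot)$ is locally bounded, and for some $\bar u\in\mathcal{S}(y)\cap\operatorname{dom}h$ and $\eta,\rho>0$, $$\|F(v)-F(u)-F'(u)(v-u)\|\le\eta\,\|u-v\|_{L^2(\Omega)}\,\|F(u)-F(v)\|\qquad\text{for all }u,v\in B_\rho(\bar u)\cap\mathscr{D}(F),$$ where $B_\rho(\bar u)$ is the open ball of radius $\rho$ around $\bar u$ in $L^2(\Omega)$. *)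

theory Defs
  imports "HOL-Analysis.Analysis"
begin

section \<open>The Hilbert space of square integrable functions\<close>

definition square_integrable :: "('a::euclidean_space \<Rightarrow> real) \<Rightarrow> bool" where
  "square_integrable f \<longleftrightarrow> f \<in> borel_measurable borel \<and> integrable lborel (\<lambda>x. (f x)\<^sup>2)"

definition L2_rel :: "('a::euclidean_space \<Rightarrow> real) \<Rightarrow> ('a \<Rightarrow> real) \<Rightarrow> bool" where
  "L2_rel f g \<longleftrightarrow> square_integrable f \<and> square_integrable g \<and> (AE x in lborel. f x = g x)"

lemma square_integrable_mult:
  assumes "square_integrable f" "square_integrable g"
  shows "integrable lborel (\<lambda>x. f x * g x)"
proof (rule Bochner_Integration.integrable_bound)
  show "integrable lborel (\<lambda>x. (f x)\<^sup>2 + (g x)\<^sup>2)"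
    using assms by (auto simp: square_integrable_def)
  show "(\<lambda>x. f x * g x) \<in> borel_measurable lborel"
    using assms by (auto simp: square_integrable_def)
  have "\<bar>a * b\<bar> \<le> a\<^sup>2 + b\<^sup>2" for a b :: real
    using sum_squares_bound[of a b] sum_squares_bound[of a "-b"] by (auto simp: abs_le_iff)
  then show "AE x in lborel. norm (f x * g x) \<le> norm ((f x)\<^sup>2 + (g x)\<^sup>2)"
    by simp
qed

lemma square_integrable_add:
  assumes "square_integrable f" "square_integrable g"
  shows "square_integrable (\<lambda>x. f x + g x)"
proof -
  have "integrable lborel (\<lambda>x. (f x)\<^sup>2 + (g x)\<^sup>2 + 2 * (f x * g x))"
    using assms square_integrable_mult[OF assms]
    by (intro Bochner_Integration.integrable_add integrable_mult_right)
       (auto simp: square_integrable_def)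
  then show ?thesis
    using assms by (auto simp: square_integrable_def power2_sum mult.assoc)
qed

lemma square_integrable_cmult:
  assumes "square_integrable f"
  shows "square_integrable (\<lambda>x. c * f x)"
  using assms by (auto simp: square_integrable_def power_mult_distrib)

lemma square_integrable_zero: "square_integrable (\<lambda>x. 0)"
  by (auto simp: square_integrable_def)

lemma square_integrable_uminus:
  assumes "square_integrable f"
  shows "square_integrable (\<lambda>x. - f x)"
  using square_integrable_cmult[OF assms, of "-1"] by simp

lemma square_integrable_diff:
  assumes "square_integrable f" "square_integrable g"
  shows "square_integrable (\<lambda>x. f x - g x)"
  using square_integrable_add[OF assms(1) square_integrable_uminus[OF assms(2)]] by simp

quotient_type (overloaded) 'a L2 = "'a::euclidean_space \<Rightarrow> real" / partial: L2_rel
  morphisms rep_L2 abs_L2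
proof (rule part_equivpI)
  show "\<exists>x. L2_rel x x"
    using square_integrable_zero by (auto simp: L2_rel_def)
  show "symp L2_rel"
    by (rule sympI) (auto simp: L2_rel_def elim: AE_mp)
  show "transp L2_rel"
    by (rule transpI) (auto simp: L2_rel_def elim: AE_mp)
qed

instantiation L2 :: (euclidean_space) real_inner
begin

lift_definition zero_L2 :: "'a L2" is "\<lambda>x. 0"
  by (simp add: L2_rel_def square_integrable_zero)

lift_definition plus_L2 :: "'a L2 \<Rightarrow> 'a L2 \<Rightarrow> 'a L2" is "\<lambda>f g x. f x + g x"
  by (auto simp: L2_rel_def square_integrable_add)

lift_definition minus_L2 :: "'a L2 \<Rightarrow> 'a L2 \<Rightarrow> 'a L2" is "\<lambda>f g x. f x - g x"
  by (auto simp: L2_rel_def square_integrable_diff)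

lift_definition uminus_L2 :: "'a L2 \<Rightarrow> 'a L2" is "\<lambda>f x. - f x"
  by (auto simp: L2_rel_def square_integrable_uminus)

lift_definition scaleR_L2 :: "real \<Rightarrow> 'a L2 \<Rightarrow> 'a L2" is "\<lambda>c f x. c * f x"
  by (auto simp: L2_rel_def square_integrable_cmult)

lift_definition inner_L2 :: "'a L2 \<Rightarrow> 'a L2 \<Rightarrow> real" is "\<lambda>f g. \<integral>x. f x * g x \<partial>lborel"
  by (rule integral_cong_AE) (auto simp: L2_rel_def square_integrable_def)

definition norm_L2 :: "'a L2 \<Rightarrow> real" where
  "norm_L2 f = sqrt (inner f f)"

definition dist_L2 :: "'a L2 \<Rightarrow> 'a L2 \<Rightarrow> real" where
  "dist_L2 f g = norm (f - g)"

definition sgn_L2 :: "'a L2 \<Rightarrow> 'a L2" where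
  "sgn_L2 f = inverse (norm f) *\<^sub>R f"

definition uniformity_L2 :: "('a L2 \<times> 'a L2) filter" where
  "uniformity_L2 = (INF e\<in>{0<..}. principal {(x, y). dist x y < e})"

definition open_L2 :: "'a L2 set \<Rightarrow> bool" where
  "open_L2 U \<longleftrightarrow> (\<forall>x\<in>U. eventually (\<lambda>(x', y). x' = x \<longrightarrow> y \<in> U) uniformity)"

instance
proof
  fix f g k :: "'a L2" and a b :: real and U :: "'a L2 set"
  show "f + g + k = f + (g + k)"
    by transfer (simp add: L2_rel_def square_integrable_add add.assoc)
  show "f + g = g + f"
    by transfer (simp add: L2_rel_def square_integrable_add add.commute)
  show "0 + f = f"
    by transfer (simp add: L2_rel_def)
  show "- f + f = 0"
    by transfer (simp add: L2_rel_def square_integrable_zero)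
  show "f - g = f + - g"
    by transfer (auto simp add: L2_rel_def intro: square_integrable_diff)
  show "a *\<^sub>R (f + g) = a *\<^sub>R f + a *\<^sub>R g"
    by transfer
       (auto simp add: L2_rel_def distrib_left intro!: square_integrable_add square_integrable_cmult)
  show "(a + b) *\<^sub>R f = a *\<^sub>R f + b *\<^sub>R f"
    by transfer
       (auto simp add: L2_rel_def distrib_right intro!: square_integrable_add square_integrable_cmult)
  show "a *\<^sub>R b *\<^sub>R f = (a * b) *\<^sub>R f"
    by transfer (auto simp add: L2_rel_def mult.assoc intro!: square_integrable_cmult)
  show "1 *\<^sub>R f = f"
    by transfer (simp add: L2_rel_def)
  show "dist f g = norm (f - g)"
    by (rule dist_L2_def)
  show "sgn f = inverse (norm f) *\<^sub>R f"
    by (rule sgn_L2_def)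
  show "uniformity = (INF e\<in>{0<..}. principal {(x::'a L2, y). dist x y < e})"
    by (rule uniformity_L2_def)
  show "open U \<longleftrightarrow> (\<forall>x\<in>U. eventually (\<lambda>(x', y). x' = x \<longrightarrow> y \<in> U) uniformity)"
    by (rule open_L2_def)
  show "inner f g = inner g f"
    by transfer (simp add: mult.commute)
  show "inner (f + g) k = inner f k + inner g k"
    by transfer (simp add: L2_rel_def distrib_right square_integrable_mult)
  show "inner (a *\<^sub>R f) g = a * inner f g"
    by transfer (simp add: mult.assoc)
  show "0 \<le> inner f f"
    by transfer simp
  show "inner f f = 0 \<longleftrightarrow> f = 0"
  proof (transfer, goal_cases)
    case (1 f)
    then have f: "integrable lborel (\<lambda>x. f x * f x)" "square_integrable f"
      by (auto simp: L2_rel_def intro: square_integrable_mult)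
    show ?case
      using integral_nonneg_eq_0_iff_AE[OF f(1)] f(2)
      by (simp add: L2_rel_def square_integrable_zero)
  qed
  show "norm f = sqrt (inner f f)"
    by (rule norm_L2_def)
qed

end

text \<open>
  The space \<open>L\<^sup>2(\<Omega>)\<close>, with each function extended by zero to the whole space:
  a closed subspace of \<open>L\<^sup>2(\<real>\<^sup>n)\<close>, with the same inner product.
\<close>

definition L2_on :: "'a::euclidean_space set \<Rightarrow> 'a L2 set" where
  "L2_on \<Omega> = {u. AE x in lborel. x \<notin> \<Omega> \<longrightarrow> rep_L2 u x = 0}"

text \<open>
  An operator on \<open>L\<^sup>2(\<Omega>)\<close> is represented by its extension by zero on the orthogonal complement
  \<open>L\<^sup>2(-\<Omega>)\<close>. This extension has the same operator norm, and its adjoint is the adjoint of the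
  given operator, with range in \<open>L\<^sup>2(\<Omega>)\<close>.
\<close>

definition lives_on :: "'a::euclidean_space set \<Rightarrow> ('a L2 \<Rightarrow>\<^sub>L 'h::real_normed_vector) \<Rightarrow> bool" where
  "lives_on \<Omega> A \<longleftrightarrow> (\<forall>w\<in>L2_on (- \<Omega>). blinfun_apply A w = 0)"


section \<open>Lipschitz domains\<close>

text \<open>
  Locally the domain is the strict epigraph of a Lipschitz function \<open>g\<close> of the component
  orthogonal to a direction \<open>e\<close>. For simplicity \<open>g\<close> is defined on the whole space, but only its
  values on the hyperplane orthogonal to \<open>e\<close> matter.
\<close>

definition lipschitz_domain :: "'a::euclidean_space set \<Rightarrow> bool" where
  "lipschitz_domain \<Omega> \<longleftrightarrow> open \<Omega> \<and> connected \<Omega> \<and> \<Omega> \<noteq> {} \<and>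
    (\<forall>x\<in>frontier \<Omega>. \<exists>e g L r. norm e = 1 \<and> 0 < r \<and> L-lipschitz_on UNIV (g :: 'a \<Rightarrow> real) \<and>
      (\<forall>z\<in>ball x r. z \<in> \<Omega> \<longleftrightarrow> g (z - (z \<bullet> e) *\<^sub>R e) < z \<bullet> e))"


section \<open>Functions of bounded variation\<close>

definition divergence :: "('a::euclidean_space \<Rightarrow> 'a) \<Rightarrow> 'a \<Rightarrow> real" where
  "divergence \<phi> x = (\<Sum>b\<in>Basis. frechet_derivative \<phi> (at x) b \<bullet> b)"

text \<open>\<open>C\<^sub>c\<^sup>1(\<Omega>; \<real>\<^sup>n)\<close>, the fields being extended by zero\<close>

definition test_fields :: "'a::euclidean_space set \<Rightarrow> ('a \<Rightarrow> 'a) set" where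
  "test_fields \<Omega> = {\<phi>.
    (\<exists>\<phi>' :: 'a \<Rightarrow> 'a \<Rightarrow>\<^sub>L 'a. continuous_on UNIV \<phi>' \<and>
       (\<forall>x. (\<phi> has_derivative blinfun_apply (\<phi>' x)) (at x))) \<and>
    compact (closure {x. \<phi> x \<noteq> 0}) \<and> closure {x. \<phi> x \<noteq> 0} \<subseteq> \<Omega>}"

definition total_variation :: "'a::euclidean_space set \<Rightarrow> ('a \<Rightarrow> real) \<Rightarrow> ereal" where
  "total_variation \<Omega> f =
    (SUP \<phi>\<in>{\<phi>\<in>test_fields \<Omega>. \<forall>x. norm (\<phi> x) \<le> 1}.
       ereal (LINT x:\<Omega>|lborel. f x * divergence \<phi> x))"

definition BV :: "'a::euclidean_space set \<Rightarrow> ('a \<Rightarrow> real) set" where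
  "BV \<Omega> = {f. set_integrable lborel \<Omega> f \<and> total_variation \<Omega> f < \<infinity>}"

text \<open>\<open>C\<^sub>0(\<Omega>; \<real>\<^sup>n)\<close>, the closure of \<open>C\<^sub>c(\<Omega>; \<real>\<^sup>n)\<close> in the supremum norm\<close>

definition vanishing_fields :: "'a::euclidean_space set \<Rightarrow> ('a \<Rightarrow> 'a) set" where
  "vanishing_fields \<Omega> = {\<phi>. continuous_on \<Omega> \<phi> \<and> (\<forall>x. x \<notin> \<Omega> \<longrightarrow> \<phi> x = 0) \<and>
    (\<forall>\<epsilon>>0. compact {x\<in>\<Omega>. \<epsilon> \<le> norm (\<phi> x)})}"

text \<open>
  The distributional gradient \<open>Df\<close> as a finite \<open>\<real>\<^sup>n\<close>-valued Radon measure on \<open>\<Omega>\<close>. Such measures are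
  taken as bounded linear functionals on \<open>C\<^sub>0(\<Omega>; \<real>\<^sup>n)\<close>; in terms of set functions,
  \<open>T \<phi> = \<integral> \<phi> \<cdot> dDf\<close>. As \<open>C\<^sub>c\<^sup>1\<close> is dense in \<open>C\<^sub>0\<close>, the values of \<open>T\<close> on \<open>C\<^sub>0\<close> are determined by \<open>f\<close>.
\<close>

definition is_gradient_measure ::
    "'a::euclidean_space set \<Rightarrow> ('a \<Rightarrow> real) \<Rightarrow> (('a \<Rightarrow> 'a) \<Rightarrow> real) \<Rightarrow> bool" where
  "is_gradient_measure \<Omega> f T \<longleftrightarrow>
    (\<forall>\<phi>\<in>vanishing_fields \<Omega>. \<forall>\<psi>\<in>vanishing_fields \<Omega>. T (\<lambda>x. \<phi> x + \<psi> x) = T \<phi> + T \<psi>) \<and>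
    (\<forall>c. \<forall>\<phi>\<in>vanishing_fields \<Omega>. T (\<lambda>x. c *\<^sub>R \<phi> x) = c * T \<phi>) \<and>
    (\<exists>C. \<forall>\<phi>\<in>vanishing_fields \<Omega>. \<forall>M. (\<forall>x. norm (\<phi> x) \<le> M) \<longrightarrow> \<bar>T \<phi>\<bar> \<le> C * M) \<and>
    (\<forall>\<phi>\<in>test_fields \<Omega>. T \<phi> = - (LINT x:\<Omega>|lborel. f x * divergence \<phi> x))"

text \<open>
  Weak-* convergence of sequences in \<open>BV(\<Omega>)\<close>: \<open>f\<^sub>k \<rightarrow> f\<close> in \<open>L\<^sup>1(\<Omega>)\<close>, and \<open>Df\<^sub>k\<close> converges to \<open>Df\<close>
  weakly-* as measures.
\<close>

definition BV_weak_star_tendsto ::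
    "'a::euclidean_space set \<Rightarrow> (nat \<Rightarrow> 'a \<Rightarrow> real) \<Rightarrow> ('a \<Rightarrow> real) \<Rightarrow> bool" where
  "BV_weak_star_tendsto \<Omega> f g \<longleftrightarrow>
    (\<forall>k. f k \<in> BV \<Omega>) \<and> g \<in> BV \<Omega> \<and>
    (\<lambda>k. LINT x:\<Omega>|lborel. \<bar>f k x - g x\<bar>) \<longlonglongrightarrow> 0 \<and>
    (\<exists>T S. (\<forall>k. is_gradient_measure \<Omega> (f k) (T k)) \<and> is_gradient_measure \<Omega> g S \<and>
      (\<forall>\<phi>\<in>vanishing_fields \<Omega>. (\<lambda>k. T k \<phi>) \<longlonglongrightarrow> S \<phi>))"


section \<open>Convex analysis in \<open>L\<^sup>2(\<Omega>)\<close>\<close>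

text \<open>
  For bounded \<open>\<Omega>\<close>, elements of \<open>L\<^sup>2(\<Omega>)\<close> are integrable on \<open>\<Omega>\<close>, so that the penalty is infinite
  exactly at the elements that are not in \<open>BV(\<Omega>)\<close>.
\<close>

definition penalty :: "'a::euclidean_space set \<Rightarrow> 'a L2 \<Rightarrow> ereal" where
  "penalty \<Omega> u = ereal ((norm u)\<^sup>2 / 2) + total_variation \<Omega> (rep_L2 u)"

definition effective_domain :: "'x set \<Rightarrow> ('x \<Rightarrow> ereal) \<Rightarrow> 'x set" where
  "effective_domain X h = {u\<in>X. h u < \<infinity>}"

definition subdifferential :: "'x::real_inner set \<Rightarrow> ('x \<Rightarrow> ereal) \<Rightarrow> 'x \<Rightarrow> 'x set" where
  "subdifferential X h u =
    {\<xi>\<in>X. u \<in> effective_domain X h \<and> (\<forall>v\<in>X. h u + ereal (\<xi> \<bullet> (v - u)) \<le> h v)}"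

definition bregman :: "('x::real_inner \<Rightarrow> ereal) \<Rightarrow> 'x \<Rightarrow> 'x \<Rightarrow> 'x \<Rightarrow> ereal" where
  "bregman h \<xi> v u = h v - h u - ereal (\<xi> \<bullet> (v - u))"


section \<open>Nonlinear operators\<close>

definition solutions :: "'x set \<Rightarrow> ('x \<Rightarrow> 'h) \<Rightarrow> 'h \<Rightarrow> 'x set" where
  "solutions D F y = {u\<in>D. F u = y}"

definition weakly_tendsto :: "(nat \<Rightarrow> 'x::real_inner) \<Rightarrow> 'x \<Rightarrow> bool" where
  "weakly_tendsto u v \<longleftrightarrow> (\<forall>w. (\<lambda>k. u k \<bullet> w) \<longlonglongrightarrow> v \<bullet> w)"

definition weakly_sequentially_closed ::
    "'x::real_inner set \<Rightarrow> ('x \<Rightarrow> 'h::real_inner) \<Rightarrow> bool" where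
  "weakly_sequentially_closed D F \<longleftrightarrow>
    (\<forall>u v z. (\<forall>k. u k \<in> D) \<and> weakly_tendsto u v \<and> weakly_tendsto (\<lambda>k. F (u k)) z
       \<longrightarrow> v \<in> D \<and> F v = z)"

definition locally_bounded_on :: "'x::metric_space set \<Rightarrow> ('x \<Rightarrow> 'b::real_normed_vector) \<Rightarrow> bool" where
  "locally_bounded_on D G \<longleftrightarrow> (\<forall>u\<in>D. \<exists>r>0. bounded (G ` (D \<inter> ball u r)))"

definition assumption_B ::
    "'x::real_inner set \<Rightarrow> ('x \<Rightarrow> 'h::real_inner) \<Rightarrow> ('x \<Rightarrow> 'x \<Rightarrow>\<^sub>L 'h) \<Rightarrow> 'x \<Rightarrow> real \<Rightarrow> real \<Rightarrow> bool" where
  "assumption_B D F F' ubar \<eta> \<rho> \<longleftrightarrow>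
    weakly_sequentially_closed D F \<and> locally_bounded_on D F' \<and> 0 < \<eta> \<and> 0 < \<rho> \<and>
    (\<forall>u\<in>ball ubar \<rho> \<inter> D. \<forall>v\<in>ball ubar \<rho> \<inter> D.
       norm (F v - F u - blinfun_apply (F' u) (v - u)) \<le> \<eta> * norm (u - v) * norm (F u - F v))"

end

theory Submission
  imports Defs "HOL-Complex_Analysis.Great_Picard"
begin

text \<open>
  The three-point identity for Bregman distances and the tangential cone condition give
  \<open>D\<^sub>k\<^sub>+\<^sub>1 + (1 - \<gamma>\<eta>) \<parallel>F(u\<^sub>k\<^sub>+\<^sub>1) - y\<parallel>\<^sup>2 / \<alpha>\<^sub>k \<le> D\<^sub>k\<close> for the Bregman distances \<open>D\<^sub>k\<close> from \<open>u\<^sub>k\<close> to the solution. By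
  strong convexity of the penalty the iterates stay in a ball around the solution; the residuals are
  square summable with weights \<open>1/\<alpha>\<^sub>k\<close>, hence they vanish and the penalty stays bounded along the
  iterates. Weak compactness in \<open>L\<^sup>2\<close> and weak closedness of \<open>F\<close> then yield a solution as the weak limit of
  a subsequence. Weak convergence in \<open>L\<^sup>2\<close> under a bound on the total variation is weak-* convergence in
  \<open>BV\<close>: \<open>\<psi> - \<psi>(\<cdot> - z)\<close> is the divergence of a field bounded by \<open>|z|\<close>, so functions of bounded variation are
  uniformly close in \<open>L\<^sup>1\<close> to their ball averages, which converge pointwise.
\<close>

section \<open>Hilbert spaces\<close>

text \<open>Two obstacles shape the estimates. The cone condition holds only near
  \<open>ubar\<close>, while the decrease that keeps \<open>u (Suc k)\<close> near
  \<open>ubar\<close> already uses it. Minimality against the competitor \<open>ubar\<close> breaks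
  this circle: it bounds the length of a step by the current Bregman distance. The constants fit:
  \<open>\<gamma>\<^sup>2 / 8\<close> is half the square of \<open>\<gamma> / 2\<close>, two such
  radii add up to \<open>\<gamma>\<close>, and within \<open>\<gamma>\<close> of the solution the
  relative linearization error is at most \<open>\<gamma> * \<eta> < 1\<close>. Secondly, bounded
  Bregman distances do not bound the penalty, because nothing controls the norm of
  \<open>\<xi> k\<close>. Only its pairing with \<open>u k - ubar\<close> matters. Unrolled over the
  update rule, this is a sum whose terms are comparable to the summable squared residuals. For BV,
  the total variation on L2 is treated as a supremum of functionals
  \<open>u \<bullet> div_L2 \<phi>\<close>, so that weak limits need only inner products. Fields
  must be supported in \<open>\<Omega>\<close>, so smoothing works only away from the boundary; the
  L2 bound takes care of the rest.\<close>

lemma quadratic_bound_imp_zero: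
  fixes a q :: real
  assumes "q \<ge> 0" and "\<And>t. t * a \<le> t\<^sup>2 * q / 2"
  shows "a = 0"
proof -
  \<comment> \<open>At \<open>t = s\<close> the hypothesis reads
    \<open>s\<^sup>2 * (q + 1) \<le> s\<^sup>2 * q / 2\<close>; the shift by one covers
    \<open>q = 0\<close>.\<close>
  define s where "s = a / (q + 1)"
  have a: "a = s * (q + 1)"
    using assms(1) by (simp add: s_def)
  have "s\<^sup>2 * (q + 2) \<le> 0"
    using assms(2)[of s] by (simp add: a power2_eq_square algebra_simps)
  then have "s = 0"
    using assms(1) by (simp add: mult_le_0_iff)
  then show ?thesis
    by (simp add: a)
qed

text \<open>The direct method: \<open>J\<close> is bounded below, the parallelogram identity makes
  minimizing sequences Cauchy, and the first variation at the minimizer is the representation.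
  Linearity is asked only on \<open>S\<close>, because the weak limit functional below is defined
  only on a subspace. With \<open>l\<close> an inner product, the result is the orthogonal
  projection onto \<open>S\<close>.\<close>

theorem riesz_representation_on:
  fixes S :: "'a::{real_inner,complete_space} set" and l :: "'a \<Rightarrow> real"
  assumes S: "subspace S" "closed S"
    and add: "\<And>x y. x \<in> S \<Longrightarrow> y \<in> S \<Longrightarrow> l (x + y) = l x + l y"
    and scale: "\<And>c x. x \<in> S \<Longrightarrow> l (c *\<^sub>R x) = c * l x"
    and bound: "\<And>x. x \<in> S \<Longrightarrow> \<bar>l x\<bar> \<le> B * norm x"
  obtains v where "v \<in> S" "\<And>w. w \<in> S \<Longrightarrow> l w = v \<bullet> w"
proof -
  define J where "J x = x \<bullet> x / 2 - l x" for x
  have "- (B\<^sup>2 / 2) \<le> J x" if "x \<in> S" for x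
  proof -
    have "0 \<le> (norm x - B)\<^sup>2" by simp
    then show ?thesis
      using bound[OF that] unfolding J_def power2_norm_eq_inner[symmetric]
      by (simp add: power2_eq_square algebra_simps)
  qed
  then have bdd: "bdd_below (J ` S)"
    by (rule bdd_belowI2)
  define m where "m = Inf (J ` S)"
  have S0: "S \<noteq> {}" using S subspace_0 by blast
  have m_le: "m \<le> J x" if "x \<in> S" for x
    unfolding m_def by (rule cINF_lower[OF bdd that])
  have "\<exists>x\<in>S. J x < m + inverse (real (Suc n))" for n
    using cINF_less_iff[OF S0 bdd, of "m + inverse (real (Suc n))"] by (simp add: m_def)
  then obtain x where x: "\<And>n. x n \<in> S" "\<And>n. J (x n) < m + inverse (real (Suc n))"
    by metis
  \<comment> \<open>Parallelogram identity at the midpoint, where \<open>J\<close> is still at least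
    \<open>m\<close>.\<close>
  have par: "(norm (a - b))\<^sup>2 / 4 \<le> (J a - m) + (J b - m)" if "a \<in> S" "b \<in> S" for a b
  proof -
    have mid: "(1/2) *\<^sub>R (a + b) \<in> S"
      using S(1) that by (intro subspace_scale subspace_add)
    have "l ((1/2) *\<^sub>R (a + b)) = (l a + l b) / 2"
      using S(1) that by (simp only: scale add subspace_add)
    then have "(norm (a - b))\<^sup>2 / 4 = J a + J b - 2 * J ((1/2) *\<^sub>R (a + b))"
      unfolding J_def power2_norm_eq_inner by (simp add: field_simps inner_simps inner_commute)
    then show ?thesis
      using m_le[OF mid] by simp
  qed
  have "Cauchy x"
    unfolding Cauchy_altdef
  proof (intro allI impI)
    fix e :: real assume "0 < e"
    then obtain N where N: "inverse (real (Suc N)) < e\<^sup>2 / 8"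
      using reals_Archimedean[of "e\<^sup>2 / 8"] by auto
    show "\<exists>M. \<forall>m\<ge>M. \<forall>n>m. dist (x m) (x n) < e"
    proof (intro exI[of _ N] allI impI)
      fix i j assume ij: "N \<le> i" "i < j"
      have "inverse (real (Suc i)) \<le> inverse (real (Suc N))" "inverse (real (Suc j)) \<le> inverse (real (Suc N))"
        using ij by (auto intro!: le_imp_inverse_le)
      then have "(norm (x i - x j))\<^sup>2 < e\<^sup>2"
        using par[OF x(1) x(1), of i j] x(2)[of i] x(2)[of j] N by linarith
      then show "dist (x i) (x j) < e"
        using \<open>0 < e\<close> by (simp add: dist_norm power2_less_imp_less)
    qed
  qed
  then obtain v where v: "x \<longlonglongrightarrow> v"
    using Cauchy_convergent_iff convergent_def by blast
  have vS: "v \<in> S"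
    using S(2) v x(1) closed_sequentially by blast
  have "(\<lambda>n. l (x n) - l v) \<longlonglongrightarrow> 0"
  proof (rule Lim_null_comparison)
    show "\<forall>\<^sub>F n in sequentially. norm (l (x n) - l v) \<le> B * norm (x n - v)"
    proof (intro always_eventually allI)
      fix n
      have "l (x n + (-1) *\<^sub>R v) = l (x n) + - 1 * l v"
        using S(1) x(1) vS by (simp only: add scale subspace_scale)
      then show "norm (l (x n) - l v) \<le> B * norm (x n - v)"
        using bound[of "x n - v"] S(1) x(1) vS by (simp add: subspace_diff)
    qed
    have "(\<lambda>n. norm (x n - v)) \<longlonglongrightarrow> 0"
      using v by (simp add: LIM_zero_iff tendsto_norm_zero)
    then show "(\<lambda>n. B * norm (x n - v)) \<longlonglongrightarrow> 0"
      by (rule tendsto_mult_right_zero)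
  qed
  then have "(\<lambda>n. J (x n)) \<longlonglongrightarrow> J v"
    unfolding J_def by (intro tendsto_intros v LIM_zero_cancel[where l = "l v"]) simp
  moreover have "(\<lambda>n. m + inverse (real (Suc n))) \<longlonglongrightarrow> m + 0"
    by (intro tendsto_intros LIMSEQ_inverse_real_of_nat)
  ultimately have Jv: "J v \<le> m"
    using x(2) by (intro LIMSEQ_le[of "\<lambda>n. J (x n)" _ "\<lambda>n. m + inverse (real (Suc n))"])
      (auto intro: less_imp_le)
  \<comment> \<open>Variation in direction \<open>w\<close>: \<open>J (v + t *\<^sub>R w)\<close> is
    at least \<open>J v\<close> for \<open>t\<close> of either sign.\<close>
  have "l w - v \<bullet> w = 0" if "w \<in> S" for w
  proof (rule quadratic_bound_imp_zero[of "w \<bullet> w"])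
    fix t
    have "J v \<le> J (v + t *\<^sub>R w)"
      using Jv m_le[of "v + t *\<^sub>R w"] S(1) vS that by (simp add: subspace_add subspace_scale)
    then show "t * (l w - v \<bullet> w) \<le> t\<^sup>2 * (w \<bullet> w) / 2"
      using S(1) vS that
      by (simp add: J_def add scale subspace_scale inner_commute power2_eq_square algebra_simps)
  qed simp
  with vS that show thesis
    by force
qed

text \<open>\<open>adjoint\<close> picks an operator by Hilbert choice, so its defining identity has
  content only once a candidate exists; Riesz representation supplies one for each
  \<open>y\<close>.\<close>

lemma adjoint_inner:
  fixes A :: "'a::{real_inner,complete_space} \<Rightarrow>\<^sub>L 'b::real_inner"
  shows "blinfun_apply A x \<bullet> y = x \<bullet> adjoint (blinfun_apply A) y"
proof -
  have "\<exists>v. \<forall>x. blinfun_apply A x \<bullet> y = x \<bullet> v" for y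
  proof -
    obtain v where v: "\<And>w. w \<in> UNIV \<Longrightarrow> blinfun_apply A w \<bullet> y = v \<bullet> w"
    proof (rule riesz_representation_on[of UNIV "\<lambda>x. blinfun_apply A x \<bullet> y" "norm A * norm y"])
      show "\<bar>blinfun_apply A x \<bullet> y\<bar> \<le> norm A * norm y * norm x" for x
      proof -
        have "\<bar>blinfun_apply A x \<bullet> y\<bar> \<le> norm (blinfun_apply A x) * norm y"
          by (rule Cauchy_Schwarz_ineq2)
        also have "\<dots> \<le> (norm A * norm x) * norm y"
          by (intro mult_right_mono norm_blinfun) simp
        finally show ?thesis by (simp add: mult_ac)
      qed
    qed (auto simp: blinfun.bilinear_simps inner_simps)
    show ?thesis
      by (intro exI[of _ v] allI) (simp only: v[OF UNIV_I] inner_commute[of v])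
  qed
  then have "\<exists>f'. \<forall>y x. blinfun_apply A x \<bullet> y = x \<bullet> f' y"
    by (rule choice[OF allI])
  then have "\<exists>f'. \<forall>x y. blinfun_apply A x \<bullet> y = x \<bullet> f' y"
    by blast
  from someI_ex[OF this] show ?thesis
    unfolding adjoint_def by blast
qed

text \<open>Testing the weak limit against \<open>v - a\<close> itself bounds its square by
  \<open>B * norm (v - a)\<close>.\<close>

lemma weakly_tendsto_norm_le:
  assumes "weakly_tendsto u v" and "\<And>k. norm (u k - a) \<le> B"
  shows "norm (v - a) \<le> B"
proof -
  have "(\<lambda>k. (u k - a) \<bullet> (v - a)) \<longlonglongrightarrow> (v - a) \<bullet> (v - a)"
    using assms(1) unfolding weakly_tendsto_def inner_diff_left
    by (intro tendsto_diff tendsto_const) blast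
  moreover have "(u k - a) \<bullet> (v - a) \<le> B * norm (v - a)" for k
    using norm_cauchy_schwarz[of "u k - a" "v - a"] mult_right_mono[OF assms(2)[of k], of "norm (v - a)"]
    by simp
  ultimately have "norm (v - a) * norm (v - a) \<le> B * norm (v - a)"
    by (intro LIMSEQ_le_const2) (auto simp: power2_norm_eq_inner[symmetric] power2_eq_square)
  then show ?thesis
    using order_trans[OF norm_ge_zero assms(2)[of 0]]
    by (cases "v = a") (auto simp: mult_le_cancel_right)
qed

lemma tendsto_imp_weakly_tendsto: "u \<longlonglongrightarrow> v \<Longrightarrow> weakly_tendsto u v"
  unfolding weakly_tendsto_def by (intro allI tendsto_inner tendsto_const)

text \<open>The space need not be separable: the diagonal argument runs over the countable set
  \<open>range u\<close>. The vectors whose pairings converge form a closed subspace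
  \<open>Z\<close> containing every \<open>u n\<close>, and the component of any \<open>w\<close>
  orthogonal to \<open>Z\<close> pairs to zero with the sequence.\<close>

theorem weak_sequential_compactness:
  fixes u :: "nat \<Rightarrow> 'a::{real_inner,complete_space}"
  assumes B: "\<And>n. norm (u n) \<le> B"
  obtains v r where "strict_mono r" "weakly_tendsto (\<lambda>k. u (r k)) v"
proof -
  have B0: "0 \<le> B"
    using B[of 0] norm_ge_zero order_trans by blast
  have ui: "\<bar>u n \<bullet> w\<bar> \<le> B * norm w" for n w
    using Cauchy_Schwarz_ineq2[of "u n" w] mult_right_mono[OF B[of n], of "norm w"] by simp
  obtain r where r: "strict_mono (r :: nat \<Rightarrow> nat)"
    and conv: "\<And>x. x \<in> range u \<Longrightarrow> \<exists>l. (\<lambda>n. u (r n) \<bullet> x) \<longlonglongrightarrow> l"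
  proof (rule function_convergent_subsequence[of "range u" "\<lambda>n x. u n \<bullet> x" "B * B"])
    fix n x assume "x \<in> range u"
    then show "norm (u n \<bullet> x) \<le> B * B"
      using ui[of n x] mult_left_mono[OF B B0] by (metis imageE order_trans real_norm_def)
  qed auto
  define Z where "Z = {w. convergent (\<lambda>n. u (r n) \<bullet> w)}"
  define l where "l w = lim (\<lambda>n. u (r n) \<bullet> w)" for w
  have l: "(\<lambda>n. u (r n) \<bullet> w) \<longlonglongrightarrow> l w" if "w \<in> Z" for w
    using that by (simp add: Z_def l_def convergent_LIMSEQ_iff)
  have ZI: "w \<in> Z" "l w = c" if "(\<lambda>n. u (r n) \<bullet> w) \<longlonglongrightarrow> c" for w c
    using that by (auto simp: Z_def l_def convergent_def limI)
  have uZ: "u n \<in> Z" for n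
    using conv[of "u n"] by (auto simp: Z_def convergent_def)
  have add: "x + y \<in> Z" "l (x + y) = l x + l y" if "x \<in> Z" "y \<in> Z" for x y
    using ZI[of "x + y" "l x + l y"] tendsto_add[OF l[OF that(1)] l[OF that(2)]]
    by (auto simp: inner_add_right)
  have scale: "c *\<^sub>R x \<in> Z" "l (c *\<^sub>R x) = c * l x" if "x \<in> Z" for c x
    using ZI[of "c *\<^sub>R x" "c * l x"] tendsto_mult_left[OF l[OF that], of c] by auto
  have Zsub: "subspace Z"
    using add scale by (auto simp: subspace_def) (simp add: Z_def convergent_const)
  have Zclosed: "closed Z"
    unfolding closed_sequential_limits
  proof (intro allI impI, elim conjE)
    fix x w assume xZ: "\<forall>n. x n \<in> Z" and xw: "x \<longlonglongrightarrow> w"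
    have "Cauchy (\<lambda>n. u (r n) \<bullet> w)"
    proof (rule metric_CauchyI)
      fix e :: real assume "0 < e"
      then have "0 < e / (3 * (B + 1))" using B0 by simp
      then obtain j where j: "norm (x j - w) < e / (3 * (B + 1))"
        using xw by (metis dist_norm lim_sequentially order_refl)
      have "B * norm (x j - w) \<le> (B + 1) * norm (x j - w)"
        by (intro mult_right_mono) auto
      also have "\<dots> < e / 3"
        using j B0 by (simp add: field_simps)
      finally have Bj: "B * norm (x j - w) < e / 3" .
      have "Cauchy (\<lambda>n. u (r n) \<bullet> x j)"
        using xZ by (simp add: Z_def convergent_Cauchy)
      then obtain N where N: "\<And>m n. m \<ge> N \<Longrightarrow> n \<ge> N \<Longrightarrow> dist (u (r m) \<bullet> x j) (u (r n) \<bullet> x j) < e / 3"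
        using \<open>0 < e\<close> by (metis Cauchy_def divide_pos_pos zero_less_numeral)
      show "\<exists>N. \<forall>m\<ge>N. \<forall>n\<ge>N. dist (u (r m) \<bullet> w) (u (r n) \<bullet> w) < e"
      proof (intro exI allI impI)
        fix m n assume "N \<le> m" "N \<le> n"
        then show "dist (u (r m) \<bullet> w) (u (r n) \<bullet> w) < e"
          using N[of m n] ui[of "r m" "x j - w"] ui[of "r n" "x j - w"] Bj
          unfolding dist_real_def inner_diff_right by linarith
      qed
    qed
    then show "w \<in> Z"
      by (simp add: Z_def Cauchy_convergent)
  qed
  have lb: "\<bar>l w\<bar> \<le> B * norm w" if "w \<in> Z" for w
    using ui by (intro LIMSEQ_le_const2[OF tendsto_rabs[OF l[OF that]]]) auto
  have "\<exists>v\<in>Z. \<forall>w\<in>Z. l w = v \<bullet> w"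
    by (rule riesz_representation_on[OF Zsub Zclosed add(2) scale(2) lb]) auto
  then obtain v where v: "v \<in> Z" "\<And>w. w \<in> Z \<Longrightarrow> l w = v \<bullet> w"
    by blast
  have "(\<lambda>n. u (r n) \<bullet> w) \<longlonglongrightarrow> v \<bullet> w" for w
  proof -
    obtain p where p: "p \<in> Z" "\<And>z. z \<in> Z \<Longrightarrow> w \<bullet> z = p \<bullet> z"
      by (rule riesz_representation_on[OF Zsub Zclosed, of "\<lambda>z. w \<bullet> z" "norm w"])
        (auto simp: inner_simps Cauchy_Schwarz_ineq2)
    show ?thesis
      using l[OF p(1)] v(2)[OF p(1)] p(2)[OF uZ] p(2)[OF v(1)] by (simp add: inner_commute)
  qed
  with r that show thesis
    by (auto simp: weakly_tendsto_def)
qed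

text \<open>The subsequence principle: a subsequence whose pairings with some \<open>w\<close> stay
  away from \<open>v \<bullet> w\<close> would, by boundedness, have a further subsequence with weak
  limit \<open>v\<close>.\<close>

lemma weakly_tendsto_if_unique_cluster:
  fixes u :: "nat \<Rightarrow> 'a::{real_inner,complete_space}"
  assumes B: "\<And>n. norm (u n) \<le> B"
    and uniq: "\<And>r w. strict_mono r \<Longrightarrow> weakly_tendsto (\<lambda>k. u (r k)) w \<Longrightarrow> w = v"
  shows "weakly_tendsto u v"
  unfolding weakly_tendsto_def
proof (intro allI, rule ccontr)
  fix w assume "\<not> (\<lambda>k. u k \<bullet> w) \<longlonglongrightarrow> v \<bullet> w"
  then obtain e where e: "0 < e" "\<And>N. \<exists>n\<ge>N. \<not> dist (u n \<bullet> w) (v \<bullet> w) < e"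
    unfolding lim_sequentially by blast
  then have "infinite {n. \<not> dist (u n \<bullet> w) (v \<bullet> w) < e}"
    unfolding infinite_nat_iff_unbounded_le by simp
  then obtain s :: "nat \<Rightarrow> nat" where s: "strict_mono s" "\<And>n. \<not> dist (u (s n) \<bullet> w) (v \<bullet> w) < e"
    using infinite_enumerate[of "{n. \<not> dist (u n \<bullet> w) (v \<bullet> w) < e}"] by auto
  obtain z r where r: "strict_mono r" "weakly_tendsto (\<lambda>k. u (s (r k))) z"
    using weak_sequential_compactness[of "\<lambda>n. u (s n)" B] B by blast
  then have "z = v"
    using uniq[of "s \<circ> r"] strict_mono_o[OF s(1) r(1)] by (simp add: o_def)
  then have "(\<lambda>k. u (s (r k)) \<bullet> w) \<longlonglongrightarrow> v \<bullet> w"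
    using r(2) by (simp add: weakly_tendsto_def)
  from tendstoD[OF this e(1)] show False
    using s(2) by simp
qed

section \<open>Completeness of the space of square integrable functions\<close>

lemma square_integrable_rep: "square_integrable (rep_L2 u)"
  using Quotient3_rep_reflp[OF Quotient3_L2, of u] by (simp add: L2_rel_def)

lemma borel_measurable_rep_L2 [measurable]: "rep_L2 u \<in> borel_measurable borel"
  using square_integrable_rep[of u] by (simp add: square_integrable_def)

lemma abs_rep_L2: "abs_L2 (rep_L2 u) = u"
  by (rule Quotient3_abs_rep[OF Quotient3_L2])

lemma rep_abs_L2: "square_integrable f \<Longrightarrow> AE x in lborel. rep_L2 (abs_L2 f) x = f x"
  using Quotient3_rep_abs[OF Quotient3_L2, of f] by (simp add: L2_rel_def)

lemma rep_L2_add: "AE x in lborel. rep_L2 (u + v) x = rep_L2 u x + rep_L2 v x"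
proof -
  have "u + v = abs_L2 (\<lambda>x. rep_L2 u x + rep_L2 v x)"
    using plus_L2.abs_eq[of "rep_L2 u" "rep_L2 v"]
    by (simp add: abs_rep_L2 L2_rel_def square_integrable_rep)
  then show ?thesis
    using rep_abs_L2[OF square_integrable_add[OF square_integrable_rep square_integrable_rep]] by metis
qed

lemma rep_L2_diff: "AE x in lborel. rep_L2 (u - v) x = rep_L2 u x - rep_L2 v x"
proof -
  have "u - v = abs_L2 (\<lambda>x. rep_L2 u x - rep_L2 v x)"
    using minus_L2.abs_eq[of "rep_L2 u" "rep_L2 v"]
    by (simp add: abs_rep_L2 L2_rel_def square_integrable_rep)
  then show ?thesis
    using rep_abs_L2[OF square_integrable_diff[OF square_integrable_rep square_integrable_rep]] by metis
qed

lemma rep_L2_scaleR: "AE x in lborel. rep_L2 (c *\<^sub>R u) x = c * rep_L2 u x"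
proof -
  have "c *\<^sub>R u = abs_L2 (\<lambda>x. c * rep_L2 u x)"
    using scaleR_L2.abs_eq[of "rep_L2 u"]
    by (simp add: abs_rep_L2 L2_rel_def square_integrable_rep)
  then show ?thesis
    using rep_abs_L2[OF square_integrable_cmult[OF square_integrable_rep]] by metis
qed

lemma inner_abs_L2:
  "square_integrable f \<Longrightarrow> square_integrable g \<Longrightarrow> abs_L2 f \<bullet> abs_L2 g = (\<integral>x. f x * g x \<partial>lborel)"
  using inner_L2.abs_eq[of f g] by (simp add: L2_rel_def)

lemma inner_rep_abs_L2:
  "square_integrable g \<Longrightarrow> u \<bullet> abs_L2 g = (\<integral>x. rep_L2 u x * g x \<partial>lborel)"
  using inner_abs_L2[OF square_integrable_rep, of g u] by (simp add: abs_rep_L2)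

lemma norm_abs_L2_square: "square_integrable f \<Longrightarrow> (norm (abs_L2 f))\<^sup>2 = (\<integral>x. (f x)\<^sup>2 \<partial>lborel)"
  using inner_abs_L2[of f f] by (simp add: power2_norm_eq_inner flip: power2_eq_square)

lemma norm_abs_L2: "square_integrable f \<Longrightarrow> norm (abs_L2 f) = sqrt (\<integral>x. (f x)\<^sup>2 \<partial>lborel)"
  using norm_abs_L2_square[of f] by (metis norm_ge_zero real_sqrt_unique)

lemma square_integrable_abs: "square_integrable f \<Longrightarrow> square_integrable (\<lambda>x. \<bar>f x\<bar>)"
  by (auto simp: square_integrable_def)

lemma integral_abs_mult_le:
  assumes "square_integrable f" "square_integrable g"
  shows "(\<integral>x. \<bar>f x * g x\<bar> \<partial>lborel) \<le> norm (abs_L2 f) * norm (abs_L2 g)"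
proof -
  have "(\<integral>x. \<bar>f x * g x\<bar> \<partial>lborel) = abs_L2 (\<lambda>x. \<bar>f x\<bar>) \<bullet> abs_L2 (\<lambda>x. \<bar>g x\<bar>)"
    using assms by (simp add: inner_abs_L2 square_integrable_abs abs_mult)
  also have "\<dots> \<le> norm (abs_L2 (\<lambda>x. \<bar>f x\<bar>)) * norm (abs_L2 (\<lambda>x. \<bar>g x\<bar>))"
    by (rule norm_cauchy_schwarz)
  also have "\<dots> = norm (abs_L2 f) * norm (abs_L2 g)"
    using assms by (simp add: norm_abs_L2 square_integrable_abs)
  finally show ?thesis .
qed

text \<open>The whole space has infinite measure, so constants will not do. Sigma-finiteness gives a
  positive integrable function, and its square root is the weight that compares L2 with L1.\<close>

lemma ex_positive_square_integrable:
  "\<exists>w :: 'a::euclidean_space \<Rightarrow> real. square_integrable w \<and> (\<forall>x. 0 < w x)"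
proof -
  obtain h :: "'a \<Rightarrow> ennreal" where h: "h \<in> borel_measurable borel" "integral\<^sup>N lborel h \<noteq> \<infinity>"
    "\<And>x. 0 < h x \<and> h x < \<infinity>"
    using sigma_finite_measure.Ex_finite_integrable_function[OF sigma_finite_lborel] by auto
  note [measurable] = h(1)
  have "integrable lborel (\<lambda>x. enn2real (h x))"
    by (rule integrableI_bounded)
      (use h in \<open>auto simp: ennreal_enn2real top.not_eq_extremum[symmetric]\<close>)
  then have "square_integrable (\<lambda>x. sqrt (enn2real (h x)))"
    by (simp add: square_integrable_def)
  moreover have "0 < sqrt (enn2real (h x))" for x
    using h(3)[of x] by (simp add: enn2real_positive_iff)
  ultimately show ?thesis
    by blast
qed

text \<open>Riesz--Fischer. Against a strictly positive weight in \<open>L\<^sup>2\<close>, an \<open>L\<^sup>2\<close>-Cauchy sequence is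
  \<open>L\<^sup>1\<close>-Cauchy, which yields an almost everywhere convergent subsequence.\<close>

instance L2 :: (euclidean_space) complete_space
proof
  fix X :: "nat \<Rightarrow> 'a L2"
  assume X: "Cauchy X"
  define f where "f n = rep_L2 (X n)" for n
  have sq: "square_integrable (f n)" for n
    by (simp add: f_def square_integrable_rep)
  have [measurable]: "f n \<in> borel_measurable borel" for n
    by (simp add: f_def)
  have fdiff: "abs_L2 (\<lambda>x. f i x - f j x) = X i - X j" for i j
    using minus_L2.abs_eq[of "f i" "f j"] sq by (simp add: f_def abs_rep_L2 L2_rel_def)
  obtain w :: "'a \<Rightarrow> real" where w: "square_integrable w" "\<And>x. 0 < w x"
    using ex_positive_square_integrable by blast
  have "\<exists>r. strict_mono r \<and> (AE x in lborel. Cauchy (\<lambda>i. f (r i) x * w x))"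
  proof (rule cauchy_L1_AE_cauchy_subseq[of lborel "\<lambda>n x. f n x * w x"])
    show "integrable lborel (\<lambda>x. f n x * w x)" for n
      by (intro square_integrable_mult sq w)
    fix e :: real assume "0 < e"
    then have "0 < e / (norm (abs_L2 w) + 1)"
      by (simp add: add_nonneg_pos)
    then obtain N where N: "\<And>i j. i \<ge> N \<Longrightarrow> j \<ge> N \<Longrightarrow> norm (X i - X j) < e / (norm (abs_L2 w) + 1)"
      using X unfolding Cauchy_def dist_norm by blast
    show "\<exists>N. \<forall>i\<ge>N. \<forall>j\<ge>N. (LINT x|lborel. norm (f i x * w x - f j x * w x)) < e"
    proof (intro exI allI impI)
      fix i j assume "N \<le> i" "N \<le> j"
      have "(LINT x|lborel. norm (f i x * w x - f j x * w x)) = (LINT x|lborel. \<bar>(f i x - f j x) * w x\<bar>)"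
        by (simp add: left_diff_distrib)
      also have "\<dots> \<le> norm (X i - X j) * norm (abs_L2 w)"
        using integral_abs_mult_le[OF square_integrable_diff[OF sq sq] w(1)] by (simp add: fdiff)
      also have "\<dots> \<le> norm (X i - X j) * (norm (abs_L2 w) + 1)"
        by (intro mult_left_mono) auto
      also have "\<dots> < e"
        using N[OF \<open>N \<le> i\<close> \<open>N \<le> j\<close>] by (simp add: pos_less_divide_eq add_nonneg_pos)
      finally show "(LINT x|lborel. norm (f i x * w x - f j x * w x)) < e" .
    qed
  qed auto
  then obtain r where r: "strict_mono r" and ae: "AE x in lborel. Cauchy (\<lambda>i. f (r i) x * w x)"
    by blast
  define g where "g x = lim (\<lambda>i. f (r i) x)" for x
  have [measurable]: "g \<in> borel_measurable borel"
    unfolding g_def by measurable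
  have lim: "AE x in lborel. (\<lambda>i. f (r i) x) \<longlonglongrightarrow> g x"
    using ae
  proof eventually_elim
    case (elim x)
    then obtain c where "(\<lambda>i. f (r i) x * w x) \<longlonglongrightarrow> c"
      using Cauchy_convergent convergent_def by blast
    then have "(\<lambda>i. f (r i) x * w x / w x) \<longlonglongrightarrow> c / w x"
      using w(2)[of x] by (intro tendsto_divide tendsto_const) auto
    then have "convergent (\<lambda>i. f (r i) x)"
      using w(2)[of x] by (auto simp: convergent_def)
    then show ?case
      by (simp add: g_def convergent_LIMSEQ_iff)
  qed
  \<comment> \<open>Fatou along the subsequence, with \<open>n\<close> fixed, shows at once that
    \<open>g - f n\<close> is square integrable and that it becomes small for the full
    sequence.\<close>
  have fatou: "\<exists>N. \<forall>n\<ge>N. (\<integral>\<^sup>+x. ennreal ((g x - f n x)\<^sup>2) \<partial>lborel) \<le> ennreal (e\<^sup>2)" if e: "0 < e" for e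
  proof -
    obtain N where N: "\<And>i j. i \<ge> N \<Longrightarrow> j \<ge> N \<Longrightarrow> norm (X i - X j) < e"
      using X e unfolding Cauchy_def dist_norm by blast
    have "(\<integral>\<^sup>+x. ennreal ((g x - f n x)\<^sup>2) \<partial>lborel) \<le> ennreal (e\<^sup>2)" if "n \<ge> N" for n
    proof -
      have "(\<integral>\<^sup>+x. ennreal ((g x - f n x)\<^sup>2) \<partial>lborel)
          = (\<integral>\<^sup>+x. liminf (\<lambda>i. ennreal ((f (r i) x - f n x)\<^sup>2)) \<partial>lborel)"
      proof (rule nn_integral_cong_AE, use lim in eventually_elim)
        case (elim x)
        have "(\<lambda>i. ennreal ((f (r i) x - f n x)\<^sup>2)) \<longlonglongrightarrow> ennreal ((g x - f n x)\<^sup>2)"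
          by (intro tendsto_ennrealI tendsto_intros elim)
        from lim_imp_Liminf[OF _ this] show ?case
          by simp
      qed
      also have "\<dots> \<le> liminf (\<lambda>i. \<integral>\<^sup>+x. ennreal ((f (r i) x - f n x)\<^sup>2) \<partial>lborel)"
        by (intro nn_integral_liminf) measurable
      also have "\<dots> \<le> liminf (\<lambda>i. ennreal (e\<^sup>2))"
      proof (rule Liminf_mono, rule eventually_sequentiallyI)
        fix i assume "i \<ge> N"
        then have "r i \<ge> N"
          using seq_suble[OF r, of i] by simp
        have sqd: "square_integrable (\<lambda>x. f (r i) x - f n x)"
          by (intro square_integrable_diff sq)
        have "(\<integral>\<^sup>+x. ennreal ((f (r i) x - f n x)\<^sup>2) \<partial>lborel) = ennreal ((norm (X (r i) - X n))\<^sup>2)"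
          using sqd norm_abs_L2_square[OF sqd]
          by (subst nn_integral_eq_integral) (auto simp: fdiff square_integrable_def)
        also have "\<dots> \<le> ennreal (e\<^sup>2)"
          using N[OF \<open>r i \<ge> N\<close> \<open>n \<ge> N\<close>] by (intro ennreal_leI power_mono) auto
        finally show "(\<integral>\<^sup>+x. ennreal ((f (r i) x - f n x)\<^sup>2) \<partial>lborel) \<le> ennreal (e\<^sup>2)" .
      qed
      finally show ?thesis
        by (simp add: Liminf_const)
    qed
    then show ?thesis
      by blast
  qed
  have sqdiff: "square_integrable (\<lambda>x. g x - f n x)"
    if "(\<integral>\<^sup>+x. ennreal ((g x - f n x)\<^sup>2) \<partial>lborel) \<le> ennreal (e\<^sup>2)" for n e
    unfolding square_integrable_def
  proof
    show "integrable lborel (\<lambda>x. (g x - f n x)\<^sup>2)"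
      by (rule integrableI_bounded) (use that in \<open>auto intro: le_less_trans\<close>)
  qed measurable
  have sqg: "square_integrable g"
  proof -
    obtain N where "(\<integral>\<^sup>+x. ennreal ((g x - f N x)\<^sup>2) \<partial>lborel) \<le> ennreal (1\<^sup>2)"
      using fatou[of 1] by auto
    from square_integrable_add[OF sqdiff[OF this] sq[of N]] show ?thesis
      by simp
  qed
  have "X \<longlonglongrightarrow> abs_L2 g"
  proof (rule LIMSEQ_I)
    fix e :: real assume "0 < e"
    then obtain N where N: "\<And>n. n \<ge> N \<Longrightarrow> (\<integral>\<^sup>+x. ennreal ((g x - f n x)\<^sup>2) \<partial>lborel) \<le> ennreal ((e / 2)\<^sup>2)"
      using fatou[of "e / 2"] by auto
    have "norm (X n - abs_L2 g) < e" if "n \<ge> N" for n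
    proof -
      note sqd = sqdiff[OF N[OF that]]
      have "abs_L2 g - X n = abs_L2 (\<lambda>x. g x - f n x)"
        using minus_L2.abs_eq[of g "f n"] sq sqg by (simp add: f_def abs_rep_L2 L2_rel_def)
      moreover have "(norm (abs_L2 (\<lambda>x. g x - f n x)))\<^sup>2 \<le> (e / 2)\<^sup>2"
        using N[OF that] sqd unfolding norm_abs_L2_square[OF sqd]
        by (subst (asm) nn_integral_eq_integral) (auto simp: square_integrable_def)
      then have "norm (abs_L2 (\<lambda>x. g x - f n x)) \<le> e / 2"
        using \<open>0 < e\<close> by (simp add: power2_le_iff_abs_le)
      ultimately show ?thesis
        using \<open>0 < e\<close> by (simp add: norm_minus_commute)
    qed
    then show "\<exists>N. \<forall>n\<ge>N. norm (X n - abs_L2 g) < e"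
      by blast
  qed
  then show "convergent X"
    by (auto simp: convergent_def)
qed

section \<open>Continuously differentiable test fields\<close>

text \<open>Continuity is asked of each directional derivative separately, which is easy to check
  for sums and products; in finite dimension it amounts to continuity in the operator norm.\<close>

definition C1 :: "('a::euclidean_space \<Rightarrow> 'b::euclidean_space) \<Rightarrow> bool" where
  "C1 f \<longleftrightarrow> (\<exists>D. (\<forall>x. (f has_derivative D x) (at x)) \<and> (\<forall>h. continuous_on UNIV (\<lambda>x. D x h)))"

lemma C1I:
  "(\<And>x. (f has_derivative D x) (at x)) \<Longrightarrow> (\<And>h. continuous_on UNIV (\<lambda>x. D x h)) \<Longrightarrow> C1 f"
  unfolding C1_def by blast

lemma C1E:
  assumes "C1 f"
  obtains D where "\<And>x. (f has_derivative D x) (at x)" "\<And>h. continuous_on UNIV (\<lambda>x. D x h)"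
  using assms unfolding C1_def by blast

lemma C1_continuous: "C1 f \<Longrightarrow> continuous_on S f"
  unfolding C1_def by (metis continuous_at_imp_continuous_on has_derivative_continuous)

lemma C1_iff_blinfun:
  fixes f :: "'a::euclidean_space \<Rightarrow> 'b::euclidean_space"
  shows "C1 f \<longleftrightarrow> (\<exists>f' :: 'a \<Rightarrow> 'a \<Rightarrow>\<^sub>L 'b. continuous_on UNIV f' \<and>
    (\<forall>x. (f has_derivative blinfun_apply (f' x)) (at x)))" (is "_ \<longleftrightarrow> ?R")
proof
  assume "C1 f"
  then obtain D where D: "\<And>x. (f has_derivative D x) (at x)" "\<And>h. continuous_on UNIV (\<lambda>x. D x h)"
    by (rule C1E) blast
  have app: "blinfun_apply (Blinfun (D x)) = D x" for x
    using D(1)[of x] by (intro bounded_linear_Blinfun_apply has_derivative_bounded_linear)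
  have "continuous_on UNIV (\<lambda>x. Blinfun (D x))"
    by (rule continuous_on_blinfun_componentwise) (simp add: app D(2))
  with D(1) app show ?R
    by (intro exI[of _ "\<lambda>x. Blinfun (D x)"]) simp
next
  assume ?R
  then show "C1 f"
    by (auto intro!: C1I blinfun.continuous_on continuous_on_const)
qed

lemma C1_const: "C1 (\<lambda>x. c)"
  by (rule C1I[where D = "\<lambda>x h. 0"]) auto

lemma C1_bounded_linear: "bounded_linear f \<Longrightarrow> C1 f"
  by (rule C1I[where D = "\<lambda>x. f"]) (auto intro: bounded_linear_imp_has_derivative)

lemma C1_add: "C1 f \<Longrightarrow> C1 g \<Longrightarrow> C1 (\<lambda>x. f x + g x)"
  by (elim C1E, rule C1I) (rule has_derivative_add continuous_on_add; assumption)+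

lemma C1_sum: "(\<And>i. i \<in> I \<Longrightarrow> C1 (f i)) \<Longrightarrow> C1 (\<lambda>x. \<Sum>i\<in>I. f i x)"
  by (induction I rule: infinite_finite_induct) (auto intro: C1_const C1_add)

lemma C1_mult:
  fixes f g :: "'a::euclidean_space \<Rightarrow> real"
  assumes f: "C1 f" and g: "C1 g"
  shows "C1 (\<lambda>x. f x * g x)"
proof -
  obtain A where A: "\<And>x. (f has_derivative A x) (at x)" "\<And>h. continuous_on UNIV (\<lambda>x. A x h)"
    using f by (rule C1E) blast
  obtain B where B: "\<And>x. (g has_derivative B x) (at x)" "\<And>h. continuous_on UNIV (\<lambda>x. B x h)"
    using g by (rule C1E) blast
  show ?thesis
    by (rule C1I[where D = "\<lambda>x h. f x * B x h + A x h * g x"])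
      (auto intro!: has_derivative_mult continuous_intros A B C1_continuous[OF f] C1_continuous[OF g])
qed

lemma C1_scaleR_const:
  assumes f: "C1 f"
  shows "C1 (\<lambda>x. f x *\<^sub>R c)"
proof -
  obtain A where A: "\<And>x. (f has_derivative A x) (at x)" "\<And>h. continuous_on UNIV (\<lambda>x. A x h)"
    using f by (rule C1E) blast
  show ?thesis
    by (rule C1I[where D = "\<lambda>x h. A x h *\<^sub>R c"])
      (auto intro!: has_derivative_scaleR_left continuous_intros A)
qed

lemma C1_const_scaleR:
  assumes f: "C1 f"
  shows "C1 (\<lambda>x. c *\<^sub>R f x)"
proof -
  obtain A where A: "\<And>x. (f has_derivative A x) (at x)" "\<And>h. continuous_on UNIV (\<lambda>x. A x h)"
    using f by (rule C1E) blast
  show ?thesis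
    by (rule C1I[where D = "\<lambda>x h. c *\<^sub>R A x h"])
      (auto intro!: has_derivative_scaleR_right continuous_intros A)
qed

lemma C1_diff: "C1 f \<Longrightarrow> C1 g \<Longrightarrow> C1 (\<lambda>x. f x - g x)"
  using C1_add[OF _ C1_const_scaleR[of g "-1"], of f] by simp

lemma C1_real_polynomial: "real_polynomial_function p \<Longrightarrow> C1 p"
  by (induction rule: real_polynomial_function.induct)
    (auto intro: C1_bounded_linear C1_const C1_add C1_mult)

text \<open>A truncation that is just once continuously differentiable, which is all that a test
  field requires: the first-order remainder is at most \<open>(s - t)\<^sup>2\<close>.\<close>

lemma max_0_square_has_derivative:
  "((\<lambda>t::real. (max 0 t)\<^sup>2) has_real_derivative 2 * max 0 t) (at t)"
proof -
  have bd: "\<bar>(max 0 s)\<^sup>2 - (max 0 t)\<^sup>2 - 2 * max 0 t * (s - t)\<bar> \<le> (s - t)\<^sup>2" for s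
  proof (cases "0 \<le> s"; cases "0 \<le> t")
    assume "0 \<le> s" "\<not> 0 \<le> t"
    then have "s\<^sup>2 \<le> (s - t)\<^sup>2" by (intro power_mono) auto
    then show ?thesis using \<open>0 \<le> s\<close> \<open>\<not> 0 \<le> t\<close> by simp
  next
    assume "\<not> 0 \<le> s" "0 \<le> t"
    then have "s * t \<le> 0" by (simp add: mult_nonpos_nonneg)
    then show ?thesis using \<open>\<not> 0 \<le> s\<close> \<open>0 \<le> t\<close>
      by (simp add: power2_eq_square left_diff_distrib right_diff_distrib abs_le_iff mult.commute)
        (use \<open>s * t \<le> 0\<close> zero_le_square[of s] zero_le_square[of t] in linarith)
  next
    assume "0 \<le> s" "0 \<le> t"
    then have "(max 0 s)\<^sup>2 - (max 0 t)\<^sup>2 - 2 * max 0 t * (s - t) = (s - t)\<^sup>2"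
      by (simp add: power2_eq_square algebra_simps)
    then show ?thesis by simp
  qed simp
  have quot: "norm (((max 0 s)\<^sup>2 - (max 0 t)\<^sup>2) / (s - t) - 2 * max 0 t) \<le> \<bar>s - t\<bar>"
    if "s \<noteq> t" for s
  proof -
    define a where "a = (max 0 s)\<^sup>2 - (max 0 t)\<^sup>2"
    have "a / (s - t) - 2 * max 0 t = (a - 2 * max 0 t * (s - t)) / (s - t)"
      using that by (simp add: diff_divide_distrib)
    then have "norm (a / (s - t) - 2 * max 0 t) = \<bar>a - 2 * max 0 t * (s - t)\<bar> / \<bar>s - t\<bar>"
      by (metis abs_divide real_norm_def)
    also have "\<dots> \<le> \<bar>s - t\<bar>\<^sup>2 / \<bar>s - t\<bar>"
      using bd[of s] unfolding a_def by (intro divide_right_mono) auto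
    also have "\<dots> = \<bar>s - t\<bar>"
      unfolding power2_eq_square by (rule nonzero_mult_div_cancel_right) (use that in simp)
    finally show ?thesis
      unfolding a_def .
  qed
  have "((\<lambda>s. ((max 0 s)\<^sup>2 - (max 0 t)\<^sup>2) / (s - t) - 2 * max 0 t) \<longlongrightarrow> 0) (at t)"
  proof (rule Lim_null_comparison)
    show "\<forall>\<^sub>F s in at t. norm (((max 0 s)\<^sup>2 - (max 0 t)\<^sup>2) / (s - t) - 2 * max 0 t) \<le> \<bar>s - t\<bar>"
      unfolding eventually_at by (intro exI[of _ 1] conjI ballI impI quot) auto
    have "isCont (\<lambda>s. \<bar>s - t\<bar>) t"
      by (intro continuous_intros)
    then show "((\<lambda>s. \<bar>s - t\<bar>) \<longlongrightarrow> 0) (at t)"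
      by (simp only: isCont_def diff_self abs_zero)
  qed
  then show ?thesis
    unfolding has_field_derivative_iff by (rule LIM_zero_cancel)
qed

lemma C1_max_0_square:
  fixes f :: "'a::euclidean_space \<Rightarrow> real"
  assumes f: "C1 f"
  shows "C1 (\<lambda>x. (max 0 (f x))\<^sup>2)"
proof -
  obtain A where A: "\<And>x. (f has_derivative A x) (at x)" "\<And>h. continuous_on UNIV (\<lambda>x. A x h)"
    using f by (rule C1E) blast
  show ?thesis
    by (rule C1I[where D = "\<lambda>x h. A x h * (2 * max 0 (f x))"])
      (auto intro!: DERIV_compose_FDERIV[OF max_0_square_has_derivative] continuous_intros A
        C1_continuous[OF f])
qed

lemma C1_dist_square: "C1 (\<lambda>x::'a::euclidean_space. (dist x c)\<^sup>2)"
proof -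
  have "C1 (\<lambda>x. (x - c) \<bullet> (x - c))"
    by (rule C1I[where D = "\<lambda>x h. (x - c) \<bullet> h + h \<bullet> (x - c)"])
      (auto intro!: derivative_eq_intros continuous_intros)
  then show ?thesis
    by (simp add: dist_norm power2_norm_eq_inner)
qed

text \<open>Finitely many balls with closures in \<open>U\<close> cover \<open>K\<close> and give a
  function \<open>s\<close> that vanishes off these closures and is positive on \<open>K\<close>,
  hence at least some \<open>m > 0\<close> there. The same truncation, applied once more, levels
  \<open>s\<close> to the constant 1 on \<open>K\<close>.\<close>

lemma C1_cutoff:
  fixes K U :: "'a::euclidean_space set"
  assumes "compact K" "open U" "K \<subseteq> U"
  obtains \<theta> S where "C1 \<theta>" "\<And>x. 0 \<le> \<theta> x" "\<And>x. \<theta> x \<le> (1::real)" "\<And>x. x \<in> K \<Longrightarrow> \<theta> x = 1"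
    "compact S" "S \<subseteq> U" "\<And>x. x \<notin> S \<Longrightarrow> \<theta> x = 0"
proof (cases "K = {}")
  case True
  show thesis
    by (rule that[of "\<lambda>x. 0" "{}"]) (auto simp: True C1_const)
next
  case False
  have "\<exists>r>0. cball x r \<subseteq> U" if "x \<in> K" for x
    using assms that open_contains_cball by blast
  then obtain r where r: "\<And>x. x \<in> K \<Longrightarrow> 0 < r x" "\<And>x. x \<in> K \<Longrightarrow> cball x (r x) \<subseteq> U"
    by metis
  obtain C where C: "C \<subseteq> K" "finite C" "K \<subseteq> (\<Union>c\<in>C. ball c (r c))"
    by (rule compactE_image[OF \<open>compact K\<close>, of K "\<lambda>c. ball c (r c)"]) (use r in force)+
  define s where "s x = (\<Sum>c\<in>C. (max 0 ((r c)\<^sup>2 - (dist x c)\<^sup>2))\<^sup>2)" for x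
  have s0: "0 \<le> s x" for x
    unfolding s_def by (intro sum_nonneg) simp
  have "C1 s"
    unfolding s_def by (intro C1_sum C1_max_0_square C1_diff C1_const C1_dist_square)
  have pos: "0 < s x" if x: "x \<in> K" for x
  proof -
    obtain c where c: "c \<in> C" "dist c x < r c"
      using C(3) x by auto
    then have "(dist x c)\<^sup>2 < (r c)\<^sup>2"
      by (intro power_strict_mono) (auto simp: dist_commute)
    with c(1) show ?thesis
      unfolding s_def by (intro sum_pos2[OF C(2) c(1)]) auto
  qed
  obtain x0 where x0: "x0 \<in> K" "\<And>x. x \<in> K \<Longrightarrow> s x0 \<le> s x"
    using continuous_attains_inf[OF \<open>compact K\<close> False C1_continuous[OF \<open>C1 s\<close>]] by blast
  define m where "m = s x0"
  have m: "0 < m" "\<And>x. x \<in> K \<Longrightarrow> m \<le> s x"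
    using x0 pos by (auto simp: m_def)
  \<comment> \<open>As a function of \<open>s x / m\<close> this rises from 0 at 0 to 1 at 1,
    arrives with slope 0 and stays constant afterwards.\<close>
  define \<theta> where "\<theta> x = 1 - (max 0 (1 - s x * (1 / m)))\<^sup>2" for x
  show thesis
  proof (rule that[of \<theta> "\<Union>c\<in>C. cball c (r c)"])
    show "C1 \<theta>"
      unfolding \<theta>_def by (intro C1_diff C1_max_0_square C1_const C1_mult \<open>C1 s\<close>)
    show "0 \<le> \<theta> x" for x
    proof -
      have "(max 0 (1 - s x * (1 / m)))\<^sup>2 \<le> 1\<^sup>2"
        using s0[of x] m(1) by (intro power_mono) auto
      then show ?thesis by (simp add: \<theta>_def)
    qed
    show "\<theta> x \<le> 1" for x
      by (simp add: \<theta>_def)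
    show "\<theta> x = 1" if "x \<in> K" for x
      using m(1) m(2)[OF that] by (simp add: \<theta>_def max_def)
    show "compact (\<Union>c\<in>C. cball c (r c))"
      using C(2) by (intro compact_UN) auto
    show "(\<Union>c\<in>C. cball c (r c)) \<subseteq> U"
      using r C(1) by blast
    show "\<theta> x = 0" if "x \<notin> (\<Union>c\<in>C. cball c (r c))" for x
    proof -
      have "(max 0 ((r c)\<^sup>2 - (dist x c)\<^sup>2))\<^sup>2 = 0" if c: "c \<in> C" for c
      proof -
        have "r c < dist x c" "0 < r c"
          using c \<open>x \<notin> _\<close> C(1) r(1) by (auto simp: dist_commute)
        then have "(r c)\<^sup>2 \<le> (dist x c)\<^sup>2"
          by (intro power_mono) auto
        then show ?thesis by simp
      qed
      then have "s x = 0"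
        unfolding s_def by (intro sum.neutral) blast
      then show ?thesis by (simp add: \<theta>_def)
    qed
  qed
qed

section \<open>Test fields and their divergences\<close>

lemma test_fields_iff:
  "\<phi> \<in> test_fields \<Omega> \<longleftrightarrow> C1 \<phi> \<and> (\<exists>K. compact K \<and> K \<subseteq> \<Omega> \<and> (\<forall>x. x \<notin> K \<longrightarrow> \<phi> x = 0))"
proof -
  have "compact (closure {x. \<phi> x \<noteq> 0}) \<and> closure {x. \<phi> x \<noteq> 0} \<subseteq> \<Omega>
      \<longleftrightarrow> (\<exists>K. compact K \<and> K \<subseteq> \<Omega> \<and> (\<forall>x. x \<notin> K \<longrightarrow> \<phi> x = 0))" (is "?L \<longleftrightarrow> ?R")
  proof
    assume ?L
    then show ?R
      using closure_subset[of "{x. \<phi> x \<noteq> 0}"] by (intro exI[of _ "closure {x. \<phi> x \<noteq> 0}"]) blast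
  next
    assume ?R
    then obtain K where K: "compact K" "K \<subseteq> \<Omega>" "\<And>x. x \<notin> K \<Longrightarrow> \<phi> x = 0"
      by blast
    then have "closure {x. \<phi> x \<noteq> 0} \<subseteq> K"
      by (intro closure_minimal compact_imp_closed) auto
    moreover from this have "closure {x. \<phi> x \<noteq> 0} = K \<inter> closure {x. \<phi> x \<noteq> 0}"
      by blast
    then have "compact (closure {x. \<phi> x \<noteq> 0})"
      using compact_Int_closed[OF K(1) closed_closure] by metis
    ultimately show ?L
      using K(2) by blast
  qed
  then show ?thesis
    by (simp add: test_fields_def C1_iff_blinfun)
qed

lemma test_fieldsI:
  "C1 \<phi> \<Longrightarrow> compact K \<Longrightarrow> K \<subseteq> \<Omega> \<Longrightarrow> (\<And>x. x \<notin> K \<Longrightarrow> \<phi> x = 0) \<Longrightarrow> \<phi> \<in> test_fields \<Omega>"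
  unfolding test_fields_iff by blast

lemma test_fieldsE:
  assumes "\<phi> \<in> test_fields \<Omega>"
  obtains K where "C1 \<phi>" "compact K" "K \<subseteq> \<Omega>" "\<And>x. x \<notin> K \<Longrightarrow> \<phi> x = 0"
  using assms unfolding test_fields_iff by blast

lemma test_fields_zero: "(\<lambda>x. 0) \<in> test_fields \<Omega>"
  by (rule test_fieldsI[of _ "{}"]) (auto intro: C1_const)

lemma test_fields_add:
  assumes "\<phi> \<in> test_fields \<Omega>" "\<psi> \<in> test_fields \<Omega>"
  shows "(\<lambda>x. \<phi> x + \<psi> x) \<in> test_fields \<Omega>"
proof -
  obtain K where K: "C1 \<phi>" "compact K" "K \<subseteq> \<Omega>" "\<And>x. x \<notin> K \<Longrightarrow> \<phi> x = 0"
    using assms(1) by (rule test_fieldsE) blast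
  obtain L where L: "C1 \<psi>" "compact L" "L \<subseteq> \<Omega>" "\<And>x. x \<notin> L \<Longrightarrow> \<psi> x = 0"
    using assms(2) by (rule test_fieldsE) blast
  show ?thesis
    using K L by (intro test_fieldsI[of _ "K \<union> L"] C1_add compact_Un) auto
qed

lemma test_fields_scaleR:
  assumes "\<phi> \<in> test_fields \<Omega>"
  shows "(\<lambda>x. c *\<^sub>R \<phi> x) \<in> test_fields \<Omega>"
proof -
  obtain K where K: "C1 \<phi>" "compact K" "K \<subseteq> \<Omega>" "\<And>x. x \<notin> K \<Longrightarrow> \<phi> x = 0"
    using assms by (rule test_fieldsE) blast
  show ?thesis
    using K by (intro test_fieldsI[of _ K] C1_const_scaleR) auto
qed

lemma test_fields_diff:
  assumes "\<phi> \<in> test_fields \<Omega>" "\<psi> \<in> test_fields \<Omega>"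
  shows "(\<lambda>x. \<phi> x - \<psi> x) \<in> test_fields \<Omega>"
  using test_fields_add[OF assms(1) test_fields_scaleR[OF assms(2), of "-1"]] by simp

lemma divergence_eq:
  "(\<phi> has_derivative D) (at x) \<Longrightarrow> divergence \<phi> x = (\<Sum>b\<in>Basis. D b \<bullet> b)"
  unfolding divergence_def by (simp add: frechet_derivative_at[symmetric])

lemma divergence_add:
  assumes "C1 \<phi>" "C1 \<psi>"
  shows "divergence (\<lambda>x. \<phi> x + \<psi> x) x = divergence \<phi> x + divergence \<psi> x"
proof -
  obtain A where A: "(\<phi> has_derivative A) (at x)"
    using assms(1) unfolding C1_def by blast
  obtain B where B: "(\<psi> has_derivative B) (at x)"
    using assms(2) unfolding C1_def by blast
  show ?thesis
    unfolding divergence_eq[OF A] divergence_eq[OF B] divergence_eq[OF has_derivative_add[OF A B]]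
    by (simp add: inner_add_left sum.distrib)
qed

lemma divergence_scaleR:
  assumes "C1 \<phi>"
  shows "divergence (\<lambda>x. c *\<^sub>R \<phi> x) x = c * divergence \<phi> x"
proof -
  obtain A where A: "(\<phi> has_derivative A) (at x)"
    using assms unfolding C1_def by blast
  show ?thesis
    unfolding divergence_eq[OF A] divergence_eq[OF has_derivative_scaleR_right[OF A]]
    by (simp add: sum_distrib_left)
qed

lemma continuous_on_divergence:
  assumes "C1 \<phi>"
  shows "continuous_on UNIV (divergence \<phi>)"
proof -
  obtain A where A: "\<And>x. (\<phi> has_derivative A x) (at x)" "\<And>h. continuous_on UNIV (\<lambda>x. A x h)"
    using assms by (rule C1E) blast
  have "divergence \<phi> = (\<lambda>x. \<Sum>b\<in>Basis. A x b \<bullet> b)"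
    using divergence_eq[OF A(1)] by blast
  then show ?thesis
    by (auto intro!: continuous_intros A(2))
qed

lemma divergence_eq_0:
  assumes "closed K" "\<And>x. x \<notin> K \<Longrightarrow> \<phi> x = 0" "x \<notin> K"
  shows "divergence \<phi> x = 0"
proof -
  have "(\<phi> has_derivative (\<lambda>h. 0)) (at x)"
  proof (rule has_derivative_transform_within_open[of "\<lambda>x. 0" _ _ _ "- K"])
    show "open (- K)" using assms(1) by auto
  qed (use assms in auto)
  then show ?thesis
    by (simp add: divergence_eq)
qed

text \<open>The test fields are dense in \<open>C\<^sub>0\<close>: cut off a polynomial that approximates the given field
  on a compact set.\<close>

lemma test_fields_dense:
  assumes "open \<Omega>" "\<phi> \<in> vanishing_fields \<Omega>" "0 < \<delta>"
  obtains \<psi> where "\<psi> \<in> test_fields \<Omega>" "\<And>x. norm (\<phi> x - \<psi> x) \<le> \<delta>"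
proof -
  define \<epsilon> where "\<epsilon> = \<delta> / 2"
  have \<epsilon>: "0 < \<epsilon>" "\<delta> = \<epsilon> + \<epsilon>" using assms(3) by (auto simp: \<epsilon>_def)
  have \<phi>: "continuous_on \<Omega> \<phi>" "\<And>x. x \<notin> \<Omega> \<Longrightarrow> \<phi> x = 0" "compact {x\<in>\<Omega>. \<epsilon> \<le> norm (\<phi> x)}"
    using assms(2) \<epsilon>(1) by (auto simp: vanishing_fields_def)
  \<comment> \<open>The cutoff is 1 wherever \<open>\<phi>\<close> is not already small, so it costs
    at most \<open>\<epsilon>\<close>; the polynomial is needed only on \<open>S\<close>.\<close>
  obtain \<theta> S where \<theta>: "C1 \<theta>" "\<And>x. 0 \<le> \<theta> x" "\<And>x. \<theta> x \<le> (1::real)"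
    "\<And>x. x \<in> {x\<in>\<Omega>. \<epsilon> \<le> norm (\<phi> x)} \<Longrightarrow> \<theta> x = 1" "compact S" "S \<subseteq> \<Omega>" "\<And>x. x \<notin> S \<Longrightarrow> \<theta> x = 0"
    by (rule C1_cutoff[OF \<phi>(3) assms(1)]) auto
  obtain p where p: "polynomial_function p" "\<And>x. x \<in> S \<Longrightarrow> norm (\<phi> x - p x) < \<epsilon>"
    using Stone_Weierstrass_polynomial_function[OF \<theta>(5) continuous_on_subset[OF \<phi>(1) \<theta>(6)] \<epsilon>(1)]
    by blast
  have "C1 (\<lambda>x. \<theta> x *\<^sub>R p x)"
  proof -
    have "real_polynomial_function (\<lambda>x. p x \<bullet> b)" for b
      using p(1) unfolding polynomial_function_def o_def by (auto intro: bounded_linear_intros)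
    then have "C1 (\<lambda>x. \<Sum>b\<in>Basis. (\<theta> x * (p x \<bullet> b)) *\<^sub>R b)"
      by (intro C1_sum C1_scaleR_const C1_mult \<theta>(1) C1_real_polynomial)
    moreover have "(\<Sum>b\<in>Basis. (\<theta> x * (p x \<bullet> b)) *\<^sub>R b) = \<theta> x *\<^sub>R p x" for x
      using euclidean_representation[of "\<theta> x *\<^sub>R p x"] by simp
    ultimately show ?thesis by simp
  qed
  then have "(\<lambda>x. \<theta> x *\<^sub>R p x) \<in> test_fields \<Omega>"
    by (rule test_fieldsI[OF _ \<theta>(5,6)]) (simp add: \<theta>(7))
  moreover have "norm (\<phi> x - \<theta> x *\<^sub>R p x) \<le> \<delta>" for x
  proof -
    have eq: "\<phi> x - \<theta> x *\<^sub>R p x = \<theta> x *\<^sub>R (\<phi> x - p x) + (1 - \<theta> x) *\<^sub>R \<phi> x"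
      by (simp add: algebra_simps)
    have "norm (\<theta> x *\<^sub>R (\<phi> x - p x)) \<le> \<epsilon>"
    proof (cases "x \<in> S")
      case True
      then show ?thesis
        using mult_mono[OF \<theta>(3)[of x] less_imp_le[OF p(2)[OF True]]] \<theta>(2)[of x] by simp
    qed (use \<theta>(7) \<epsilon> in auto)
    moreover have "norm ((1 - \<theta> x) *\<^sub>R \<phi> x) \<le> \<epsilon>"
    proof (cases "x \<in> \<Omega> \<and> \<epsilon> \<le> norm (\<phi> x)")
      case False
      then have "norm (\<phi> x) \<le> \<epsilon>"
        using \<phi>(2) \<epsilon> by fastforce
      then show ?thesis
        using mult_mono[of "1 - \<theta> x" 1 "norm (\<phi> x)" \<epsilon>] \<theta>(2,3)[of x] by simp
    qed (use \<theta>(4) \<epsilon> in auto)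
    ultimately show ?thesis
      unfolding eq \<epsilon>(2) by (rule norm_triangle_le[OF add_mono])
  qed
  ultimately show thesis
    by (rule that)
qed

section \<open>Total variation and strong convexity of the penalty\<close>

lemma square_integrable_compact_support:
  fixes g :: "'a::euclidean_space \<Rightarrow> real"
  assumes g: "continuous_on UNIV g" and K: "compact K" "\<And>x. x \<notin> K \<Longrightarrow> g x = 0"
  shows "square_integrable g"
proof -
  have "integrable lborel (\<lambda>x. indicator K x *\<^sub>R (g x)\<^sup>2)"
    by (intro borel_integrable_compact K continuous_intros continuous_on_subset[OF g]) auto
  also have "(\<lambda>x. indicator K x *\<^sub>R (g x)\<^sup>2) = (\<lambda>x. (g x)\<^sup>2)"
    using K(2) by (auto simp: indicator_def fun_eq_iff)
  finally show ?thesis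
    using g by (auto simp: square_integrable_def intro: borel_measurable_continuous_onI)
qed

text \<open>With this element the variation of an L2 function becomes a supremum of continuous
  linear functionals, so that weak limits and convex combinations are handled by inner products
  alone.\<close>

definition div_L2 :: "('a::euclidean_space \<Rightarrow> 'a) \<Rightarrow> 'a L2" where
  "div_L2 \<phi> = abs_L2 (divergence \<phi>)"

lemma square_integrable_divergence:
  assumes "\<phi> \<in> test_fields \<Omega>"
  shows "square_integrable (divergence \<phi>)"
proof -
  obtain K where K: "C1 \<phi>" "compact K" "K \<subseteq> \<Omega>" "\<And>x. x \<notin> K \<Longrightarrow> \<phi> x = 0"
    using assms by (rule test_fieldsE) blast
  show ?thesis
    using K divergence_eq_0[of K \<phi>]
    by (intro square_integrable_compact_support[of _ K] continuous_on_divergence)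
      (auto intro: compact_imp_closed)
qed

lemma div_L2_add:
  assumes "\<phi> \<in> test_fields \<Omega>" "\<psi> \<in> test_fields \<Omega>"
  shows "div_L2 (\<lambda>x. \<phi> x + \<psi> x) = div_L2 \<phi> + div_L2 \<psi>"
proof -
  have "divergence (\<lambda>x. \<phi> x + \<psi> x) = (\<lambda>x. divergence \<phi> x + divergence \<psi> x)"
    using assms by (intro ext divergence_add) (auto elim: test_fieldsE)
  then show ?thesis
    using plus_L2.abs_eq[of "divergence \<phi>" "divergence \<psi>"] assms
    by (simp add: div_L2_def L2_rel_def square_integrable_divergence)
qed

lemma div_L2_scaleR:
  assumes "\<phi> \<in> test_fields \<Omega>"
  shows "div_L2 (\<lambda>x. c *\<^sub>R \<phi> x) = c *\<^sub>R div_L2 \<phi>"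
proof -
  have "divergence (\<lambda>x. c *\<^sub>R \<phi> x) = (\<lambda>x. c * divergence \<phi> x)"
    using assms by (intro ext divergence_scaleR) (auto elim: test_fieldsE)
  then show ?thesis
    using scaleR_L2.abs_eq[of "divergence \<phi>" c] assms
    by (simp add: div_L2_def L2_rel_def square_integrable_divergence)
qed

lemma div_L2_diff:
  assumes "\<phi> \<in> test_fields \<Omega>" "\<psi> \<in> test_fields \<Omega>"
  shows "div_L2 (\<lambda>x. \<phi> x - \<psi> x) = div_L2 \<phi> - div_L2 \<psi>"
  using div_L2_add[OF assms(1) test_fields_scaleR[OF assms(2), of "-1"]]
    div_L2_scaleR[OF assms(2), of "-1"] by simp

lemma div_L2_zero: "div_L2 (\<lambda>x. 0) = 0"
  using div_L2_scaleR[OF test_fields_zero, of 0] by simp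

lemma set_integral_divergence:
  assumes "\<phi> \<in> test_fields \<Omega>"
  shows "(LINT x:\<Omega>|lborel. rep_L2 u x * divergence \<phi> x) = u \<bullet> div_L2 \<phi>"
proof -
  obtain K where K: "C1 \<phi>" "compact K" "K \<subseteq> \<Omega>" "\<And>x. x \<notin> K \<Longrightarrow> \<phi> x = 0"
    using assms by (rule test_fieldsE) blast
  have "indicator \<Omega> x *\<^sub>R (rep_L2 u x * divergence \<phi> x) = rep_L2 u x * divergence \<phi> x" for x
    using K divergence_eq_0[OF compact_imp_closed[OF K(2)], of \<phi> x] by (auto simp: indicator_def)
  then show ?thesis
    unfolding div_L2_def inner_rep_abs_L2[OF square_integrable_divergence[OF assms]]
      set_lebesgue_integral_def by presburger
qed

lemma total_variation_L2:
  "total_variation \<Omega> (rep_L2 u) =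
    (SUP \<phi>\<in>{\<phi>\<in>test_fields \<Omega>. \<forall>x. norm (\<phi> x) \<le> 1}. ereal (u \<bullet> div_L2 \<phi>))"
  unfolding total_variation_def by (intro SUP_cong) (auto simp: set_integral_divergence)

lemma total_variation_le_iff:
  "total_variation \<Omega> (rep_L2 u) \<le> ereal c \<longleftrightarrow>
    (\<forall>\<phi>\<in>test_fields \<Omega>. (\<forall>x. norm (\<phi> x) \<le> 1) \<longrightarrow> u \<bullet> div_L2 \<phi> \<le> c)"
  unfolding total_variation_L2 by (auto simp: SUP_le_iff)

lemma total_variation_nonneg: "0 \<le> total_variation \<Omega> (rep_L2 u)"
proof -
  have "ereal (u \<bullet> div_L2 (\<lambda>x. 0)) \<le> total_variation \<Omega> (rep_L2 u)"
    unfolding total_variation_L2 by (rule SUP_upper) (auto intro: test_fields_zero)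
  then show ?thesis
    by (simp add: div_L2_zero zero_ereal_def)
qed

text \<open>Homogeneity scales the bound for fields of norm at most 1, and the field
  \<open>- \<phi>\<close> gives the other sign. The case \<open>M = 0\<close> cannot be scaled, but
  forces the zero field.\<close>

lemma inner_div_L2_le:
  assumes c: "total_variation \<Omega> (rep_L2 u) \<le> ereal c"
    and \<phi>: "\<phi> \<in> test_fields \<Omega>" and M: "\<And>x. norm (\<phi> x) \<le> M"
  shows "\<bar>u \<bullet> div_L2 \<phi>\<bar> \<le> c * M"
proof -
  have *: "u \<bullet> div_L2 \<psi> \<le> c * M" if \<psi>: "\<psi> \<in> test_fields \<Omega>" "\<And>x. norm (\<psi> x) \<le> M" for \<psi>
  proof (cases "M = 0")
    case True
    then have "\<psi> = (\<lambda>x. 0)"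
      using \<psi>(2) by auto
    then show ?thesis
      using True by (simp add: div_L2_zero)
  next
    case False
    then have "0 < M"
      using order_trans[OF norm_ge_zero \<psi>(2)] by (simp add: less_le)
    then have "u \<bullet> div_L2 (\<lambda>x. (1 / M) *\<^sub>R \<psi> x) \<le> c"
      using \<psi> c unfolding total_variation_le_iff by (auto simp: test_fields_scaleR)
    then show ?thesis
      using \<open>0 < M\<close> by (simp add: div_L2_scaleR[OF \<psi>(1)] field_simps)
  qed
  have "u \<bullet> div_L2 (\<lambda>x. (-1) *\<^sub>R \<phi> x) \<le> c * M"
    using M by (intro * test_fields_scaleR \<phi>) simp
  then show ?thesis
    using *[OF \<phi> M] unfolding div_L2_scaleR[OF \<phi>] by (simp add: abs_le_iff)
qed

text \<open>Lower semicontinuity of a supremum of weakly continuous functionals.\<close>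

lemma total_variation_le_weak_limit:
  assumes "weakly_tendsto u v" and "\<And>k. total_variation \<Omega> (rep_L2 (u k)) \<le> ereal c"
  shows "total_variation \<Omega> (rep_L2 v) \<le> ereal c"
  unfolding total_variation_le_iff
proof (intro ballI impI)
  fix \<phi> assume "\<phi> \<in> test_fields \<Omega>" "\<forall>x. norm (\<phi> x) \<le> 1"
  then have "u k \<bullet> div_L2 \<phi> \<le> c" for k
    using assms(2)[of k] unfolding total_variation_le_iff by blast
  moreover have "(\<lambda>k. u k \<bullet> div_L2 \<phi>) \<longlonglongrightarrow> v \<bullet> div_L2 \<phi>"
    using assms(1) unfolding weakly_tendsto_def by blast
  ultimately show "v \<bullet> div_L2 \<phi> \<le> c"
    by (intro LIMSEQ_le_const2) auto
qed

lemma total_variation_diff_le: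
  assumes "total_variation \<Omega> (rep_L2 u) \<le> ereal a" and "total_variation \<Omega> (rep_L2 v) \<le> ereal b"
  shows "total_variation \<Omega> (rep_L2 (u - v)) \<le> ereal (a + b)"
  unfolding total_variation_le_iff
proof (intro ballI impI)
  fix \<phi> assume "\<phi> \<in> test_fields \<Omega>" "\<forall>x. norm (\<phi> x) \<le> 1"
  then show "(u - v) \<bullet> div_L2 \<phi> \<le> a + b"
    using inner_div_L2_le[OF assms(1), of \<phi> 1] inner_div_L2_le[OF assms(2), of \<phi> 1]
    by (simp add: inner_diff_left)
qed

lemma total_variation_convex_combination:
  assumes "total_variation \<Omega> (rep_L2 u) \<le> ereal a" and "total_variation \<Omega> (rep_L2 v) \<le> ereal b"
    and "0 \<le> t" "t \<le> 1"
  shows "total_variation \<Omega> (rep_L2 ((1 - t) *\<^sub>R u + t *\<^sub>R v)) \<le> ereal ((1 - t) * a + t * b)"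
  using assms unfolding total_variation_le_iff
  by (auto simp: inner_add_left intro!: add_mono mult_left_mono)

lemma L2_on_combination:
  assumes "u \<in> L2_on \<Omega>" "v \<in> L2_on \<Omega>"
  shows "a *\<^sub>R u + b *\<^sub>R v \<in> L2_on \<Omega>"
proof -
  have "AE x in lborel. x \<notin> \<Omega> \<longrightarrow> rep_L2 (a *\<^sub>R u + b *\<^sub>R v) x = 0"
    using rep_L2_add[of "a *\<^sub>R u" "b *\<^sub>R v"] rep_L2_scaleR[of a u] rep_L2_scaleR[of b v]
      assms[unfolded L2_on_def mem_Collect_eq]
    by eventually_elim auto
  then show ?thesis
    by (simp add: L2_on_def)
qed

lemma penalty_finiteE:
  assumes "penalty \<Omega> u < \<infinity>"
  obtains a where "total_variation \<Omega> (rep_L2 u) = ereal a" "penalty \<Omega> u = ereal ((norm u)\<^sup>2 / 2 + a)"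
    "0 \<le> a"
  using assms total_variation_nonneg[of \<Omega> u]
  by (cases "total_variation \<Omega> (rep_L2 u)") (auto simp: penalty_def)

lemma le_zero_if_le_small_multiple:
  fixes X q :: real
  assumes "0 \<le> q" and "\<And>t. 0 < t \<Longrightarrow> t < 1 \<Longrightarrow> X \<le> t * q"
  shows "X \<le> 0"
proof (rule field_le_epsilon)
  fix e :: real assume "0 < e"
  define t where "t = min (1/2) (e / (q + 1))"
  have "0 < t" "t < 1" "t \<le> e / (q + 1)"
    using \<open>0 < e\<close> assms(1) by (auto simp: t_def)
  have "t * q \<le> e / (q + 1) * q"
    using \<open>t \<le> e / (q + 1)\<close> assms(1) by (rule mult_right_mono)
  moreover have "e / (q + 1) * q \<le> e"
    using assms(1) \<open>0 < e\<close> by (simp add: field_simps)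
  ultimately show "X \<le> 0 + e"
    using assms(2)[OF \<open>0 < t\<close> \<open>t < 1\<close>] by linarith
qed

text \<open>The quadratic part of the penalty makes it strongly convex.\<close>

lemma bregman_ge_square:
  assumes \<xi>: "\<xi> \<in> subdifferential (L2_on \<Omega>) (penalty \<Omega>) u"
    and v: "v \<in> L2_on \<Omega>" "penalty \<Omega> v = ereal hv" and hu: "penalty \<Omega> u = ereal hu"
  shows "(norm (v - u))\<^sup>2 / 2 \<le> hv - hu - \<xi> \<bullet> (v - u)"
proof -
  have u: "u \<in> L2_on \<Omega>"
    and sub: "\<And>w. w \<in> L2_on \<Omega> \<Longrightarrow> penalty \<Omega> u + ereal (\<xi> \<bullet> (w - u)) \<le> penalty \<Omega> w"
    using \<xi> by (auto simp: subdifferential_def effective_domain_def)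
  obtain a where a: "total_variation \<Omega> (rep_L2 u) = ereal a" "hu = (norm u)\<^sup>2 / 2 + a"
    using penalty_finiteE[of \<Omega> u] hu by auto
  obtain b where b: "total_variation \<Omega> (rep_L2 v) = ereal b" "hv = (norm v)\<^sup>2 / 2 + b"
    using penalty_finiteE[of \<Omega> v] v(2) by auto
  define d where "d = v - u"
  \<comment> \<open>The subgradient inequality on the segment from \<open>u\<close> to
    \<open>v\<close>, divided by \<open>t\<close>, shows in the limit that \<open>\<xi> - u\<close>
    acts as a subgradient of the total variation towards \<open>v\<close>. The quadratic part then
    contributes exactly half the squared distance.\<close>
  have "\<xi> \<bullet> d - u \<bullet> d - (b - a) \<le> 0"
  proof (rule le_zero_if_le_small_multiple[of "d \<bullet> d / 2"])
    fix t :: real assume t: "0 < t" "t < 1"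
    define w where "w = (1 - t) *\<^sub>R u + t *\<^sub>R v"
    have w: "w = u + t *\<^sub>R d"
      by (simp add: w_def d_def algebra_simps)
    have "penalty \<Omega> w \<le> ereal ((norm w)\<^sup>2 / 2) + ereal ((1 - t) * a + t * b)"
      unfolding penalty_def w_def
      using total_variation_convex_combination[of \<Omega> u a v b t] a b t by (intro add_left_mono) auto
    moreover have "ereal hu + ereal (\<xi> \<bullet> (w - u)) \<le> penalty \<Omega> w"
      using sub[of w] u v(1) hu by (simp add: w_def L2_on_combination)
    ultimately have "hu + \<xi> \<bullet> (w - u) \<le> (norm w)\<^sup>2 / 2 + ((1 - t) * a + t * b)"
      by (metis ereal_less_eq(3) order_trans plus_ereal.simps(1))
    then have "t * (\<xi> \<bullet> d - u \<bullet> d - (b - a)) \<le> t * (t * (d \<bullet> d / 2))"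
      unfolding a(2) w power2_norm_eq_inner
      by (simp add: algebra_simps inner_commute power2_eq_square add_divide_distrib)
    then show "\<xi> \<bullet> d - u \<bullet> d - (b - a) \<le> t * (d \<bullet> d / 2)"
      using t(1) by (simp only: mult_le_cancel_left_pos)
  qed simp
  then show ?thesis
    unfolding a(2) b(2) power2_norm_eq_inner d_def
    by (simp add: algebra_simps inner_commute add_divide_distrib diff_divide_distrib)
qed

section \<open>Translations and ball averages\<close>

text \<open>The difference of a test function and its translate is the divergence of a field bounded by
  the length of the translation.\<close>

lemma translation_estimate:
  fixes \<psi> :: "'a::euclidean_space \<Rightarrow> real"
  assumes tv: "total_variation \<Omega> (rep_L2 u) \<le> ereal c"
    and \<psi>: "C1 \<psi>" "\<And>x. \<bar>\<psi> x\<bar> \<le> 1"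
    and K: "compact K" "\<And>x. x \<notin> K \<Longrightarrow> \<psi> x = 0" "\<And>x. x \<in> K \<Longrightarrow> cball x (norm z) \<subseteq> \<Omega>"
  shows "(\<integral>x. rep_L2 u x * (\<psi> x - \<psi> (x - z)) \<partial>lborel) \<le> c * norm z"
proof -
  obtain \<psi>' :: "'a \<Rightarrow> 'a \<Rightarrow>\<^sub>L real" where \<psi>': "continuous_on UNIV \<psi>'"
    "\<And>x. (\<psi> has_derivative blinfun_apply (\<psi>' x)) (at x)"
    using \<psi>(1) unfolding C1_iff_blinfun by blast
  \<comment> \<open>\<open>g x\<close> averages \<open>\<psi>\<close> over the segment from
    \<open>x - z\<close> to \<open>x\<close>, so its derivative along \<open>z\<close> is the
    difference of the endpoint values. The field sought is \<open>g x *\<^sub>R z\<close>.\<close>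
  define g where "g x = integral (cbox 0 1) (\<lambda>t::real. \<psi> (x - t *\<^sub>R z))" for x
  define G where "G x = integral (cbox 0 1) (\<lambda>t::real. \<psi>' (x - t *\<^sub>R z))" for x
  have shift: "((\<lambda>x. \<psi> (x - t *\<^sub>R z)) has_derivative blinfun_apply (\<psi>' (x - t *\<^sub>R z))) (at x)" for x t
    by (rule has_derivative_compose[of "\<lambda>x. x - t *\<^sub>R z" "\<lambda>h. h" x UNIV, OF _ \<psi>'(2)])
      (auto intro!: derivative_eq_intros)
  have cont': "continuous_on (UNIV \<times> cbox 0 1) (\<lambda>(x, t). \<psi>' (x - t *\<^sub>R z))"
    unfolding split_beta by (intro continuous_on_compose2[OF \<psi>'(1)] continuous_intros) auto
  have cont0: "continuous_on (cbox 0 1) (\<lambda>t::real. \<psi> (x - t *\<^sub>R z))" for x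
    by (intro continuous_on_compose2[OF C1_continuous[OF \<psi>(1), of UNIV]] continuous_intros) auto
  have cont1: "continuous_on (cbox 0 1) (\<lambda>t::real. \<psi>' (x - t *\<^sub>R z))" for x
    by (intro continuous_on_compose2[OF \<psi>'(1)] continuous_intros) auto
  have g_der: "(g has_derivative blinfun_apply (G x)) (at x)" for x
    unfolding g_def[abs_def] G_def
    by (rule leibniz_rule[OF shift _ cont']) (intro integrable_continuous cont0 UNIV_I convex_UNIV)+
  have G_cont: "continuous_on UNIV G"
    unfolding G_def[abs_def] by (rule integral_continuous_on_param[OF cont'])
  have Gz: "blinfun_apply (G x) z = \<psi> x - \<psi> (x - z)" for x
  proof -
    have "((\<lambda>t. - \<psi> (x - t *\<^sub>R z)) has_vector_derivative blinfun_apply (\<psi>' (x - t *\<^sub>R z)) z)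
        (at t within {0..1})" for t
    proof -
      have "((\<lambda>t. x - t *\<^sub>R z) has_derivative (\<lambda>s. - (s *\<^sub>R z))) (at t within {0..1})"
        by (auto intro!: derivative_eq_intros)
      from has_derivative_minus[OF has_derivative_compose[OF this \<psi>'(2)]] show ?thesis
        by (simp add: has_vector_derivative_def blinfun.bilinear_simps)
    qed
    then have "((\<lambda>t. blinfun_apply (\<psi>' (x - t *\<^sub>R z)) z) has_integral
        (- \<psi> (x - 1 *\<^sub>R z)) - (- \<psi> (x - 0 *\<^sub>R z))) {0..1}"
      by (intro fundamental_theorem_of_calculus) auto
    then show ?thesis
      unfolding G_def blinfun_apply_integral[OF integrable_continuous[OF cont1]]
      by (simp add: integral_unique)
  qed
  define \<phi> where "\<phi> x = g x *\<^sub>R z" for x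
  have \<phi>_der: "(\<phi> has_derivative (\<lambda>h. blinfun_apply (G x) h *\<^sub>R z)) (at x)" for x
    unfolding \<phi>_def[abs_def] by (intro has_derivative_scaleR_left g_der)
  have "C1 \<phi>"
    by (rule C1I[OF \<phi>_der]) (intro continuous_intros G_cont)
  have div: "divergence \<phi> x = \<psi> x - \<psi> (x - z)" for x
  proof -
    have "divergence \<phi> x = blinfun_apply (G x) (\<Sum>b\<in>Basis. (z \<bullet> b) *\<^sub>R b)"
      unfolding divergence_eq[OF \<phi>_der] by (simp add: blinfun.bilinear_simps mult.commute)
    then show ?thesis
      by (simp add: euclidean_representation Gz)
  qed
  \<comment> \<open>The Minkowski sum of \<open>K\<close> and the segment from 0 to
    \<open>z\<close>; it lies in the balls that \<open>K(3)\<close> places inside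
    \<open>\<Omega>\<close>.\<close>
  define K' where "K' = (\<lambda>p. fst p + snd p *\<^sub>R z) ` (K \<times> {0..1::real})"
  have "\<phi> \<in> test_fields \<Omega>"
  proof (rule test_fieldsI[OF \<open>C1 \<phi>\<close>, of K'])
    show "compact K'"
      unfolding K'_def by (intro compact_continuous_image compact_Times K continuous_intros) auto
    have "x + t *\<^sub>R z \<in> \<Omega>" if "x \<in> K" "0 \<le> t" "t \<le> 1" for x t
    proof -
      have "dist x (x + t *\<^sub>R z) \<le> norm z"
        using that by (simp add: dist_norm mult_left_le_one_le)
      then show ?thesis
        using K(3)[OF that(1)] by (auto simp: subset_eq)
    qed
    then show "K' \<subseteq> \<Omega>"
      by (auto simp: K'_def)
    fix x assume x: "x \<notin> K'"
    have "\<psi> (x - t *\<^sub>R z) = 0" if "t \<in> cbox 0 1" for t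
    proof (rule K(2))
      show "x - t *\<^sub>R z \<notin> K"
      proof
        assume "x - t *\<^sub>R z \<in> K"
        then have "x \<in> K'"
          using that unfolding K'_def by (intro image_eqI[of _ _ "(x - t *\<^sub>R z, t)"]) auto
        with x show False ..
      qed
    qed
    then have "g x = integral (cbox 0 1) (\<lambda>t::real. 0)"
      unfolding g_def by (intro integral_cong) auto
    then show "\<phi> x = 0"
      by (simp add: \<phi>_def)
  qed
  moreover have "norm (\<phi> x) \<le> norm z" for x
  proof -
    have "norm (g x) \<le> 1 * (1 - 0)"
      unfolding g_def cbox_interval by (rule integral_bound) (use cont0 \<psi>(2) in auto)
    then show ?thesis
      by (simp add: \<phi>_def mult_left_le_one_le)
  qed
  ultimately have "u \<bullet> div_L2 \<phi> \<le> c * norm z"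
    using inner_div_L2_le[OF tv] by (meson abs_le_D1)
  then show ?thesis
    using inner_rep_abs_L2[OF square_integrable_divergence[OF \<open>\<phi> \<in> test_fields \<Omega>\<close>], of u]
    by (simp add: div_L2_def div)
qed

section \<open>Translation invariance and averages over balls\<close>

lemma lborel_translation:
  fixes f :: "'a::euclidean_space \<Rightarrow> real"
  assumes [measurable]: "f \<in> borel_measurable borel"
  shows "(\<integral>x. f (z + x) \<partial>lborel) = (\<integral>x. f x \<partial>lborel)"
    and "integrable lborel (\<lambda>x. f (z + x)) \<longleftrightarrow> integrable lborel f"
proof -
  have "(\<integral>x. f x \<partial>distr lborel borel ((+) z)) = (\<integral>x. f (z + x) \<partial>lborel)"
    by (rule integral_distr) measurable
  then show "(\<integral>x. f (z + x) \<partial>lborel) = (\<integral>x. f x \<partial>lborel)"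
    by (simp add: lborel_distr_plus)
  have "integrable (distr lborel borel ((+) z)) f \<longleftrightarrow> integrable lborel (\<lambda>x. f (z + x))"
    by (rule integrable_distr_eq) measurable
  then show "integrable lborel (\<lambda>x. f (z + x)) \<longleftrightarrow> integrable lborel f"
    by (simp add: lborel_distr_plus)
qed

lemma square_integrable_translation:
  "square_integrable f \<Longrightarrow> square_integrable (\<lambda>x. f (z + x))"
  using lborel_translation(2)[of "\<lambda>x. (f x)\<^sup>2" z] by (auto simp: square_integrable_def)

lemma norm_abs_L2_translation:
  assumes "square_integrable f"
  shows "norm (abs_L2 (\<lambda>x. f (z + x))) = norm (abs_L2 f)"
  using assms lborel_translation(1)[of "\<lambda>x. (f x)\<^sup>2" z]
  by (simp add: norm_abs_L2 square_integrable_translation) (auto simp: square_integrable_def)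

lemma square_integrable_indicator:
  assumes "A \<in> sets borel" "emeasure lborel A < \<infinity>"
  shows "square_integrable (indicator A)"
proof -
  have "(\<lambda>x. (indicator A x)\<^sup>2) = (indicator A :: 'a \<Rightarrow> real)"
    by (auto simp: indicator_def)
  then show ?thesis
    using assms by (simp add: square_integrable_def)
qed

lemma norm_abs_L2_indicator:
  assumes "A \<in> sets borel" "emeasure lborel A < \<infinity>"
  shows "norm (abs_L2 (indicator A)) = sqrt (measure lborel A)"
proof -
  have "(\<lambda>x. (indicator A x)\<^sup>2) = (indicator A :: 'a \<Rightarrow> real)"
    by (auto simp: indicator_def)
  then show ?thesis
    using assms by (simp add: norm_abs_L2 square_integrable_indicator)
qed

lemma square_integrable_indicator_cball: "square_integrable (indicator (cball x r))"
  by (rule square_integrable_indicator[OF _ emeasure_lborel_cball_finite]) simp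

lemma cball_in_sets_borel [measurable]: "cball (x :: 'a::euclidean_space) r \<in> sets borel"
  by simp

lemma sets_pair_lborel:
  "borel_measurable (lborel \<Otimes>\<^sub>M lborel) = borel_measurable (borel \<Otimes>\<^sub>M borel)"
  by (intro measurable_cong_sets sets_pair_measure_cong) simp_all

text \<open>Written as an inner product, so that weak convergence gives convergence at every single
  point \<open>x\<close>.\<close>

definition ball_average :: "real \<Rightarrow> 'a::euclidean_space L2 \<Rightarrow> 'a \<Rightarrow> real" where
  "ball_average r u x = u \<bullet> abs_L2 (indicator (cball x r)) / measure lborel (cball (0::'a) r)"

text \<open>With the ball moved to the origin, joint measurability in \<open>x\<close> and
  \<open>z\<close> is evident, as measurability in \<open>x\<close> and Fubini require.\<close>

lemma inner_indicator_cball: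
  "u \<bullet> abs_L2 (indicator (cball x r)) = (\<integral>z. indicator (cball 0 r) z * rep_L2 u (x + z) \<partial>lborel)"
proof -
  have "u \<bullet> abs_L2 (indicator (cball x r)) = (\<integral>y. rep_L2 u y * indicator (cball x r) y \<partial>lborel)"
    by (rule inner_rep_abs_L2[OF square_integrable_indicator_cball])
  also have "\<dots> = (\<integral>z. rep_L2 u (x + z) * indicator (cball x r) (x + z) \<partial>lborel)"
    by (rule lborel_translation(1)[symmetric]) measurable
  also have "\<dots> = (\<integral>z. indicator (cball 0 r) z * rep_L2 u (x + z) \<partial>lborel)"
    by (intro Bochner_Integration.integral_cong) (auto simp: indicator_def dist_norm)
  finally show ?thesis .
qed

lemma ball_average_measurable [measurable]: "ball_average r u \<in> borel_measurable borel"
proof -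
  have "(\<lambda>x. \<integral>z. indicator (cball 0 r) z * rep_L2 u (x + z) \<partial>lborel) \<in> borel_measurable lborel"
    by (rule lborel.borel_measurable_lebesgue_integral, unfold sets_pair_lborel) measurable
  then have "(\<lambda>x. u \<bullet> abs_L2 (indicator (cball x r))) \<in> borel_measurable borel"
    by (simp add: inner_indicator_cball)
  then show ?thesis
    unfolding ball_average_def[abs_def] by (rule borel_measurable_divide) simp
qed

text \<open>Cauchy-Schwarz, the norm of the indicator being independent of the centre. The bound is
  uniform in \<open>x\<close> and later provides the dominating function.\<close>

lemma ball_average_le:
  "\<bar>ball_average r u (x::'a::euclidean_space)\<bar> \<le>
    norm u * sqrt (measure lborel (cball (0::'a) r)) / measure lborel (cball (0::'a) r)"
proof -
  have "norm (abs_L2 (indicator (cball x r))) = norm (abs_L2 (indicator (cball (0::'a) r)))"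
  proof -
    have "(\<lambda>y. indicator (cball x r) (x + y)) = (indicator (cball 0 r) :: 'a \<Rightarrow> real)"
      by (auto simp: indicator_def dist_norm)
    then show ?thesis
      using norm_abs_L2_translation[OF square_integrable_indicator_cball[of x r], of x] by simp
  qed
  also have "\<dots> = sqrt (measure lborel (cball (0::'a) r))"
    by (rule norm_abs_L2_indicator[OF _ emeasure_lborel_cball_finite]) simp
  finally have "\<bar>u \<bullet> abs_L2 (indicator (cball x r))\<bar> \<le> norm u * sqrt (measure lborel (cball (0::'a) r))"
    using Cauchy_Schwarz_ineq2[of u "abs_L2 (indicator (cball x r))"] by simp
  then show ?thesis
    unfolding ball_average_def abs_divide by (simp add: divide_right_mono)
qed

lemma integrable_ball_average:
  assumes "compact (K :: 'a::euclidean_space set)"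
  shows "integrable lborel (\<lambda>x. indicator K x * \<bar>ball_average r u x\<bar>)"
proof (rule Bochner_Integration.integrable_bound)
  let ?C = "norm u * sqrt (measure lborel (cball (0::'a) r)) / measure lborel (cball (0::'a) r)"
  show "integrable lborel (\<lambda>x. indicator K x * ?C)"
    using assms by (intro integrable_mult_left integrable_real_indicator)
      (auto simp: compact_imp_closed simp del: infinity_ennreal_def intro: emeasure_compact_finite)
  show "(\<lambda>x. indicator K x * \<bar>ball_average r u x\<bar>) \<in> borel_measurable lborel"
    using assms by (auto intro!: borel_measurable_times borel_measurable_indicator simp: compact_imp_closed)
  show "AE x in lborel. norm (indicator K x * \<bar>ball_average r u x\<bar>) \<le> norm (indicator K x * ?C)"
    using ball_average_le[of r u] by (auto simp: indicator_def)
qed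

text \<open>Averaging the translation estimate over a ball replaces the function by its ball averages.\<close>

lemma integral_test_le_ball_average:
  fixes \<psi> :: "'a::euclidean_space \<Rightarrow> real"
  assumes tv: "total_variation \<Omega> (rep_L2 u) \<le> ereal c" and "0 \<le> c" and "0 < r"
    and \<psi>: "C1 \<psi>" "\<And>x. \<bar>\<psi> x\<bar> \<le> 1"
    and K: "compact K" "\<And>x. x \<notin> K \<Longrightarrow> \<psi> x = 0" "\<And>x. x \<in> K \<Longrightarrow> cball x r \<subseteq> \<Omega>"
  shows "(\<integral>x. rep_L2 u x * \<psi> x \<partial>lborel) \<le> c * r + (\<integral>x. indicator K x * \<bar>ball_average r u x\<bar> \<partial>lborel)"
proof -
  define V where "V = measure lborel (cball (0::'a) r)"
  have "0 < V"
    using \<open>0 < r\<close> by (simp add: V_def content_cball_pos)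
  define B where "B = cball (0::'a) r"
  have [measurable]: "B \<in> sets borel"
    by (simp add: B_def)
  have B_fin: "emeasure lborel B < \<infinity>"
    unfolding B_def by (rule emeasure_lborel_cball_finite)
  define w where "w = rep_L2 u"
  have w: "square_integrable w" and [measurable]: "w \<in> borel_measurable borel"
    by (simp_all add: w_def square_integrable_rep)
  have \<psi>sq: "square_integrable \<psi>"
    by (rule square_integrable_compact_support[OF C1_continuous[OF \<psi>(1)] K(1,2)])
  then have [measurable]: "\<psi> \<in> borel_measurable borel"
    by (simp add: square_integrable_def)
  define I where "I = (\<integral>x. w x * \<psi> x \<partial>lborel)"
  \<comment> \<open>A translate of the function, paired with \<open>\<psi>\<close>. Shifting the
    translation onto \<open>\<psi>\<close> exposes \<open>I - h z\<close> to the translation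
    estimate.\<close>
  define h where "h z = (\<integral>x. w (z + x) * \<psi> x \<partial>lborel)" for z
  have Ih: "I \<le> c * r + h z" if "z \<in> B" for z
  proof -
    have nz: "norm z \<le> r"
      using that by (simp add: B_def)
    have \<psi>sh: "square_integrable (\<lambda>x. \<psi> (x - z))"
      using square_integrable_translation[OF \<psi>sq, of "- z"] by simp
    have "h z = (\<integral>x. w (z + x) * \<psi> ((z + x) - z) \<partial>lborel)"
      by (simp add: h_def)
    also have "\<dots> = (\<integral>x. w x * \<psi> (x - z) \<partial>lborel)"
      by (rule lborel_translation(1)) measurable
    finally have "I - h z = (\<integral>x. w x * (\<psi> x - \<psi> (x - z)) \<partial>lborel)"
      unfolding I_def right_diff_distrib
      by (subst Bochner_Integration.integral_diff) (auto intro!: square_integrable_mult w \<psi>sq \<psi>sh)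
    also have "\<dots> \<le> c * norm z"
      unfolding w_def
    proof (rule translation_estimate[OF tv \<psi> K(1,2)])
      show "cball x (norm z) \<subseteq> \<Omega>" if "x \<in> K" for x
        using K(3)[OF that] nz by (auto simp: subset_eq)
    qed
    also have "\<dots> \<le> c * r"
      using nz \<open>0 \<le> c\<close> by (rule mult_left_mono)
    finally show ?thesis by simp
  qed
  \<comment> \<open>Integration over \<open>x\<close> first gives \<open>h\<close> on the ball;
    integration over \<open>z\<close> first gives \<open>\<psi>\<close> times \<open>V\<close> times
    the ball average. Fubini equates the two.\<close>
  define f where "f = (\<lambda>(z, x). indicator B z * (w (z + x) * \<psi> x))"
  have f_int: "integrable (lborel \<Otimes>\<^sub>M lborel) f"
  proof (rule lborel_pair.Fubini_integrable)
    show f_meas: "f \<in> borel_measurable (lborel \<Otimes>\<^sub>M lborel)"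
      unfolding f_def sets_pair_lborel by measurable
    show "integrable lborel (\<lambda>z. \<integral>x. norm (f (z, x)) \<partial>lborel)"
    proof (rule Bochner_Integration.integrable_bound)
      show "integrable lborel (\<lambda>z. indicator B z * (norm u * norm (abs_L2 \<psi>)))"
        using B_fin by (intro integrable_mult_left integrable_real_indicator) auto
      show "(\<lambda>z. \<integral>x. norm (f (z, x)) \<partial>lborel) \<in> borel_measurable lborel"
        by (rule lborel.borel_measurable_lebesgue_integral) (use f_meas in \<open>simp add: split_beta'\<close>)
      have "(\<integral>x. \<bar>w (z + x) * \<psi> x\<bar> \<partial>lborel) \<le> norm u * norm (abs_L2 \<psi>)" for z
        using integral_abs_mult_le[OF square_integrable_translation[OF w] \<psi>sq, of z]
        by (simp add: norm_abs_L2_translation[OF w]) (simp add: w_def abs_rep_L2)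
      then show "AE z in lborel. norm (\<integral>x. norm (f (z, x)) \<partial>lborel)
          \<le> norm (indicator B z * (norm u * norm (abs_L2 \<psi>)))"
        by (auto simp: f_def indicator_def abs_mult)
    qed
    show "AE z in lborel. integrable lborel (\<lambda>x. f (z, x))"
      unfolding f_def
      by (auto intro!: integrable_mult_right square_integrable_mult square_integrable_translation w \<psi>sq)
  qed
  have fz: "(\<integral>x. f (z, x) \<partial>lborel) = indicator B z * h z" for z
    by (simp add: f_def h_def)
  have fx: "(\<integral>z. f (z, x) \<partial>lborel) = \<psi> x * (V * ball_average r u x)" for x
  proof -
    have "(\<integral>z. f (z, x) \<partial>lborel) = (\<integral>z. \<psi> x * (indicator B z * w (x + z)) \<partial>lborel)"
      by (intro Bochner_Integration.integral_cong) (simp_all add: f_def add.commute)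
    also have "\<dots> = \<psi> x * (V * ball_average r u x)"
      using \<open>0 < V\<close> by (simp add: ball_average_def inner_indicator_cball B_def w_def V_def)
    finally show ?thesis .
  qed
  have hB_int: "integrable lborel (\<lambda>z. indicator B z * h z)"
    using lborel_pair.integrable_fst'[OF f_int] by (simp add: fz)
  have "V * (I - c * r) = (\<integral>z. indicator B z * (I - c * r) \<partial>lborel)"
    by (simp add: V_def B_def)
  also have "\<dots> \<le> (\<integral>z. indicator B z * h z \<partial>lborel)"
  proof (rule integral_mono[OF _ hB_int])
    show "integrable lborel (\<lambda>z. indicator B z * (I - c * r))"
      using B_fin by (intro integrable_mult_left integrable_real_indicator) auto
    show "indicator B z * (I - c * r) \<le> indicator B z * h z" for z
      using Ih[of z] by (auto simp: indicator_def)
  qed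
  also have "\<dots> = (\<integral>x. \<psi> x * (V * ball_average r u x) \<partial>lborel)"
    unfolding fz[symmetric] fx[symmetric]
    by (rule lborel_pair.Fubini_integral[symmetric]) (simp add: f_int)
  also have "\<dots> \<le> (\<integral>x. V * (indicator K x * \<bar>ball_average r u x\<bar>) \<partial>lborel)"
  proof (rule integral_mono)
    show "integrable lborel (\<lambda>x. \<psi> x * (V * ball_average r u x))"
      unfolding fx[symmetric] by (rule lborel_pair.integrable_snd) (simp add: f_int)
    show "integrable lborel (\<lambda>x. V * (indicator K x * \<bar>ball_average r u x\<bar>))"
      by (intro integrable_mult_right integrable_ball_average K)
    show "\<psi> x * (V * ball_average r u x) \<le> V * (indicator K x * \<bar>ball_average r u x\<bar>)" for x
    proof (cases "x \<in> K")
      case True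
      have "\<psi> x * ball_average r u x \<le> \<bar>\<psi> x\<bar> * \<bar>ball_average r u x\<bar>"
        by (metis abs_ge_self abs_mult)
      also have "\<dots> \<le> 1 * \<bar>ball_average r u x\<bar>"
        by (intro mult_right_mono \<psi>(2)) simp
      finally show ?thesis
        using True \<open>0 < V\<close> by (simp add: mult.left_commute)
    qed (simp add: K(2))
  qed
  also have "\<dots> = V * (\<integral>x. indicator K x * \<bar>ball_average r u x\<bar> \<partial>lborel)"
    by simp
  finally have "I - c * r \<le> (\<integral>x. indicator K x * \<bar>ball_average r u x\<bar> \<partial>lborel)"
    using \<open>0 < V\<close> by (simp only: mult_le_cancel_left_pos)
  then show ?thesis
    unfolding I_def w_def by linarith
qed

section \<open>Weak convergence and weak-* convergence in BV\<close>

text \<open>\<open>measurable_on\<close> means being a limit of continuous functions off a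
  negligible set; the almost everywhere statement then passes from the completed measure to
  \<open>lborel\<close>.\<close>

lemma ex_continuous_AE_limit:
  fixes f :: "'a::euclidean_space \<Rightarrow> real"
  assumes [measurable]: "f \<in> borel_measurable borel"
  obtains g where "\<And>n. continuous_on UNIV (g n)" "AE x in lborel. (\<lambda>n. g n x) \<longlonglongrightarrow> f x"
proof -
  have "f \<in> borel_measurable lebesgue"
    by (rule measurable_completion) simp
  then have "f measurable_on UNIV"
    by (rule lebesgue_measurable_imp_measurable_on_real) simp
  then obtain N g where g: "negligible N" "\<And>n. continuous_on UNIV (g n)"
    "\<And>x. x \<notin> N \<Longrightarrow> (\<lambda>n. g n x) \<longlonglongrightarrow> f x"
    unfolding measurable_on_def by auto
  have "AE x in lebesgue. (\<lambda>n. g n x) \<longlonglongrightarrow> f x"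
    using AE_not_in[of N lebesgue] g(1,3) by (auto simp: negligible_iff_null_sets elim: eventually_mono)
  with g(2) that show thesis
    by (auto simp: AE_completion_iff)
qed

text \<open>The function \<open>sgn \<circ> w\<close> is an almost everywhere limit of continuous functions, and these are
  uniformly approximated on \<open>S\<close> by polynomials.\<close>

lemma integral_abs_cutoff_le:
  fixes w \<theta> :: "'a::euclidean_space \<Rightarrow> real"
  assumes w: "square_integrable w" and \<theta>: "C1 \<theta>" "\<And>x. 0 \<le> \<theta> x" "\<And>x. \<theta> x \<le> 1"
    and S: "compact S" "\<And>x. x \<notin> S \<Longrightarrow> \<theta> x = 0"
    and M: "\<And>\<psi>. C1 \<psi> \<Longrightarrow> (\<And>x. \<bar>\<psi> x\<bar> \<le> 1) \<Longrightarrow> (\<And>x. x \<notin> S \<Longrightarrow> \<psi> x = 0) \<Longrightarrow>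
      (\<integral>x. w x * \<psi> x \<partial>lborel) \<le> M"
  shows "(\<integral>x. \<bar>w x\<bar> * \<theta> x \<partial>lborel) \<le> M"
proof -
  have [measurable]: "w \<in> borel_measurable borel"
    using w by (simp add: square_integrable_def)
  have sq: "square_integrable (\<lambda>x. \<theta> x * h x)" if "continuous_on UNIV h" for h
    by (rule square_integrable_compact_support[OF _ S(1)])
      (auto intro!: continuous_intros C1_continuous[OF \<theta>(1)] that simp: S(2))
  have int_h: "integrable lborel (\<lambda>x. w x * (\<theta> x * h x))" if "continuous_on UNIV h" for h
    by (intro square_integrable_mult w sq that)
  have int_abs: "integrable lborel (\<lambda>x. \<bar>w x\<bar> * \<theta> x)"
    using square_integrable_mult[OF square_integrable_abs[OF w] sq[of "\<lambda>x. 1"]] by simp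
  have "0 \<le> M"
    using M[of "\<lambda>x. 0"] by (simp add: C1_const)
  define Q where "Q = (\<integral>x. \<bar>w x\<bar> * \<theta> x \<partial>lborel)"
  have "0 \<le> Q"
    unfolding Q_def by (intro Bochner_Integration.integral_nonneg) (simp add: \<theta>(2))
  have cont: "(\<integral>x. w x * (\<theta> x * h x) \<partial>lborel) \<le> M"
    if h: "continuous_on UNIV h" "\<And>x. \<bar>h x\<bar> \<le> 1" for h
  proof -
    have "(\<integral>x. w x * (\<theta> x * h x) \<partial>lborel) - M \<le> 0"
    proof (rule le_zero_if_le_small_multiple[of "M + Q"])
      fix t :: real assume t: "0 < t" "t < 1"
      obtain p where p: "real_polynomial_function p" "\<And>x. x \<in> S \<Longrightarrow> \<bar>h x - p x\<bar> < t"
        using Stone_Weierstrass_real_polynomial_function[OF S(1) continuous_on_subset[OF h(1)] t(1)]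
        by auto
      have pc: "continuous_on UNIV p"
        by (intro C1_continuous C1_real_polynomial p)
      \<comment> \<open>On \<open>S\<close> the polynomial is bounded by \<open>1 + t\<close>, hence
        the scaling; off \<open>S\<close> it may be large, but there \<open>\<theta>\<close>
        vanishes.\<close>
      have "(\<integral>x. w x * ((1 / (1 + t)) * (\<theta> x * p x)) \<partial>lborel) \<le> M"
      proof (rule M)
        show "C1 (\<lambda>x. 1 / (1 + t) * (\<theta> x * p x))"
          by (intro C1_mult C1_const \<theta>(1) C1_real_polynomial p)
        show "\<bar>1 / (1 + t) * (\<theta> x * p x)\<bar> \<le> 1" for x
        proof (cases "x \<in> S")
          case True
          then have "\<bar>p x\<bar> \<le> 1 + t"
            using p(2)[OF True] h(2)[of x] by linarith
          then have "\<theta> x * \<bar>p x\<bar> \<le> 1 * (1 + t)"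
            using \<theta>(2,3) t by (intro mult_mono) auto
          then show ?thesis
            using \<theta>(2)[of x] t by (simp add: abs_mult)
        qed (simp add: S(2))
      qed (simp add: S(2))
      then have "(\<integral>x. w x * (\<theta> x * p x) \<partial>lborel) \<le> (1 + t) * M"
        using t by (simp add: mult.left_commute[of _ "1 / (1 + t)"] pos_divide_le_eq mult.commute)
      moreover have "(\<integral>x. w x * (\<theta> x * h x) \<partial>lborel) - (\<integral>x. w x * (\<theta> x * p x) \<partial>lborel) \<le> t * Q"
      proof -
        have "(\<integral>x. w x * (\<theta> x * h x) \<partial>lborel) - (\<integral>x. w x * (\<theta> x * p x) \<partial>lborel)
            = (\<integral>x. w x * (\<theta> x * h x) - w x * (\<theta> x * p x) \<partial>lborel)"
          by (rule Bochner_Integration.integral_diff[symmetric]) (intro int_h h pc)+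
        also have "\<dots> \<le> (\<integral>x. t * (\<bar>w x\<bar> * \<theta> x) \<partial>lborel)"
        proof (rule integral_mono)
          show "integrable lborel (\<lambda>x. w x * (\<theta> x * h x) - w x * (\<theta> x * p x))"
            by (intro Bochner_Integration.integrable_diff int_h h pc)
          show "integrable lborel (\<lambda>x. t * (\<bar>w x\<bar> * \<theta> x))"
            by (intro integrable_mult_right int_abs)
          show "w x * (\<theta> x * h x) - w x * (\<theta> x * p x) \<le> t * (\<bar>w x\<bar> * \<theta> x)" for x
          proof (cases "x \<in> S")
            case True
            have "w x * (\<theta> x * h x) - w x * (\<theta> x * p x) = (w x * (h x - p x)) * \<theta> x"
              by (simp add: algebra_simps)
            also have "\<dots> \<le> (\<bar>w x\<bar> * \<bar>h x - p x\<bar>) * \<theta> x"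
              by (intro mult_right_mono \<theta>(2)) (metis abs_ge_self abs_mult)
            also have "\<dots> \<le> (\<bar>w x\<bar> * t) * \<theta> x"
              using p(2)[OF True] by (intro mult_right_mono mult_left_mono \<theta>(2)) auto
            finally show ?thesis
              by (simp add: mult_ac)
          qed (simp add: S(2))
        qed
        finally show ?thesis
          by (simp add: Q_def)
      qed
      ultimately show "(\<integral>x. w x * (\<theta> x * h x) \<partial>lborel) - M \<le> t * (M + Q)"
        by (simp add: algebra_simps)
    qed (use \<open>0 \<le> M\<close> \<open>0 \<le> Q\<close> in simp)
    then show ?thesis by simp
  qed
  obtain g where g: "\<And>n. continuous_on UNIV (g n)" "AE x in lborel. (\<lambda>n. g n x) \<longlonglongrightarrow> sgn (w x)"
    by (rule ex_continuous_AE_limit[of "\<lambda>x. sgn (w x)"]) auto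
  \<comment> \<open>Clamping makes the approximants admissible and leaves the limit
    \<open>sgn (w x)\<close> unchanged.\<close>
  define h where "h n x = max (-1) (min 1 (g n x))" for n x
  have h: "continuous_on UNIV (h n)" "\<bar>h n x\<bar> \<le> 1" for n x
    unfolding h_def[abs_def] by (auto intro!: continuous_intros g(1))
  have [measurable]: "h n \<in> borel_measurable borel" "\<theta> \<in> borel_measurable borel" for n
    using h(1) C1_continuous[OF \<theta>(1), of UNIV] by (auto intro: borel_measurable_continuous_onI)
  have "(\<lambda>n. \<integral>x. w x * (\<theta> x * h n x) \<partial>lborel) \<longlonglongrightarrow> (\<integral>x. \<bar>w x\<bar> * \<theta> x \<partial>lborel)"
  proof (rule integral_dominated_convergence[where w = "\<lambda>x. \<bar>w x\<bar> * \<theta> x"])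
    show "AE x in lborel. (\<lambda>n. w x * (\<theta> x * h n x)) \<longlonglongrightarrow> \<bar>w x\<bar> * \<theta> x"
      using g(2)
    proof eventually_elim
      case (elim x)
      have "(\<lambda>n. w x * (\<theta> x * h n x)) \<longlonglongrightarrow> w x * (\<theta> x * max (-1) (min 1 (sgn (w x))))"
        unfolding h_def by (intro tendsto_intros elim)
      moreover have "w x * (\<theta> x * max (-1) (min 1 (sgn (w x)))) = \<bar>w x\<bar> * \<theta> x"
        by (auto simp: sgn_if)
      ultimately show ?case by simp
    qed
    show "AE x in lborel. norm (w x * (\<theta> x * h n x)) \<le> \<bar>w x\<bar> * \<theta> x" for n
    proof (rule AE_I2)
      fix x
      have "\<bar>w x\<bar> * (\<theta> x * \<bar>h n x\<bar>) \<le> \<bar>w x\<bar> * (\<theta> x * 1)"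
        by (intro mult_left_mono \<theta>(2) h(2)) simp
      then show "norm (w x * (\<theta> x * h n x)) \<le> \<bar>w x\<bar> * \<theta> x"
        using \<theta>(2)[of x] by (simp add: abs_mult)
    qed
  qed (use int_abs in auto)
  then show ?thesis
    by (rule LIMSEQ_le_const2) (intro exI[of _ 0] allI impI cont h)
qed

text \<open>Smoothing costs \<open>c * r\<close>, uniformly in \<open>k\<close>, and the ball
  averages tend to 0 pointwise and boundedly on a compact set. The cutoff provides a set
  \<open>S\<close> with room for balls inside \<open>\<Omega>\<close>, as the translations
  require.\<close>

lemma L1_tendsto_zero_on_compact:
  fixes w :: "nat \<Rightarrow> 'a::euclidean_space L2"
  assumes "open \<Omega>" and weak: "weakly_tendsto w 0" and B: "\<And>k. norm (w k) \<le> B"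
    and tv: "\<And>k. total_variation \<Omega> (rep_L2 (w k)) \<le> ereal c"
    and K: "compact K" "K \<subseteq> \<Omega>"
  shows "(\<lambda>k. \<integral>x. indicator K x * \<bar>rep_L2 (w k) x\<bar> \<partial>lborel) \<longlonglongrightarrow> 0"
proof (rule tendstoI)
  fix e :: real assume "0 < e"
  have "0 \<le> c"
    using order_trans[OF total_variation_nonneg tv] by simp
  obtain \<theta> S where \<theta>: "C1 \<theta>" "\<And>x. 0 \<le> \<theta> x" "\<And>x. \<theta> x \<le> (1::real)" "\<And>x. x \<in> K \<Longrightarrow> \<theta> x = 1"
    and S: "compact S" "S \<subseteq> \<Omega>" "\<And>x. x \<notin> S \<Longrightarrow> \<theta> x = 0"
    by (rule C1_cutoff[OF K(1) \<open>open \<Omega>\<close> K(2)]) auto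
  obtain r0 where r0: "0 < r0" "(\<Union>x\<in>S. cball x r0) \<subseteq> \<Omega>"
    using compact_subset_open_imp_cball_epsilon_subset[OF S(1) \<open>open \<Omega>\<close> S(2)] by blast
  \<comment> \<open>The second entry makes \<open>c * r\<close> at most \<open>e / 2\<close>;
    \<open>c + 1\<close> avoids a division by zero.\<close>
  define r where "r = min r0 (e / (2 * (c + 1)))"
  have r: "0 < r" "r \<le> r0" "r \<le> e / (2 * (c + 1))"
    using r0(1) \<open>0 < e\<close> \<open>0 \<le> c\<close> by (auto simp: r_def)
  have "c * r \<le> (c + 1) * r"
    using r(1) by simp
  also have "\<dots> \<le> e / 2"
  proof -
    have "0 < 2 * (c + 1)"
      using \<open>0 \<le> c\<close> by simp
    then have "r * (2 * (c + 1)) \<le> e"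
      using r(3) pos_le_divide_eq by blast
    then show ?thesis by (simp add: algebra_simps)
  qed
  finally have cr: "c * r \<le> e / 2" .
  have Sr: "cball x r \<subseteq> \<Omega>" if "x \<in> S" for x
    using r0(2) r(2) that by (auto simp: subset_eq)
  define A where "A k = (\<integral>x. indicator S x * \<bar>ball_average r (w k) x\<bar> \<partial>lborel)" for k
  define C where "C = B * sqrt (measure lborel (cball (0::'a) r)) / measure lborel (cball (0::'a) r)"
  have [measurable]: "S \<in> sets borel"
    using S(1) by (simp add: compact_imp_closed)
  have "(\<lambda>k. A k) \<longlonglongrightarrow> (\<integral>x. 0 \<partial>(lborel :: 'a measure))"
    unfolding A_def
  proof (rule integral_dominated_convergence[where w = "\<lambda>x. indicator S x * C"])
    show "integrable lborel (\<lambda>x. indicator S x * C)"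
      using emeasure_compact_finite[OF S(1)] by (intro integrable_mult_left integrable_real_indicator) auto
    have "(\<lambda>k. w k \<bullet> v) \<longlonglongrightarrow> 0" for v
      using weak by (simp add: weakly_tendsto_def)
    then have "(\<lambda>k. ball_average r (w k) x) \<longlonglongrightarrow> 0" for x
      unfolding ball_average_def by (intro tendsto_divide_zero)
    from tendsto_mult_right_zero[OF tendsto_rabs_zero[OF this]]
    show "AE x in lborel. (\<lambda>k. indicator S x * \<bar>ball_average r (w k) x\<bar>) \<longlonglongrightarrow> 0"
      by (intro AE_I2) blast
    have "\<bar>ball_average r (w k) x\<bar> \<le> C" for k x
    proof -
      have "norm (w k) * sqrt (measure lborel (cball (0::'a) r)) / measure lborel (cball (0::'a) r) \<le> C"
        unfolding C_def by (intro divide_right_mono mult_right_mono B) simp_all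
      with ball_average_le show ?thesis
        by (rule order_trans)
    qed
    then show "AE x in lborel. norm (indicator S x * \<bar>ball_average r (w k) x\<bar>) \<le> indicator S x * C" for k
      by (auto simp: indicator_def)
  qed measurable
  then have "\<forall>\<^sub>F k in sequentially. \<bar>A k\<bar> < e / 2"
    using tendstoD[of A 0 sequentially "e / 2"] \<open>0 < e\<close> by simp
  then show "\<forall>\<^sub>F k in sequentially. dist (\<integral>x. indicator K x * \<bar>rep_L2 (w k) x\<bar> \<partial>lborel) 0 < e"
  proof eventually_elim
    case (elim k)
    have int_\<theta>: "integrable lborel (\<lambda>x. \<bar>rep_L2 (w k) x\<bar> * \<theta> x)"
      by (intro square_integrable_mult square_integrable_abs square_integrable_rep
          square_integrable_compact_support[OF C1_continuous[OF \<theta>(1)] S(1,3)])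
    have "(\<integral>x. indicator K x * \<bar>rep_L2 (w k) x\<bar> \<partial>lborel) \<le> (\<integral>x. \<bar>rep_L2 (w k) x\<bar> * \<theta> x \<partial>lborel)"
      by (rule integral_mono'[OF int_\<theta>]) (simp_all add: indicator_def \<theta>(2,4))
    also have "\<dots> \<le> c * r + A k"
    proof (rule integral_abs_cutoff_le[OF square_integrable_rep \<theta>(1-3) S(1,3)])
      fix \<psi> :: "'a \<Rightarrow> real"
      assume "C1 \<psi>" "\<And>x. \<bar>\<psi> x\<bar> \<le> 1" "\<And>x. x \<notin> S \<Longrightarrow> \<psi> x = 0"
      then show "(\<integral>x. rep_L2 (w k) x * \<psi> x \<partial>lborel) \<le> c * r + A k"
        unfolding A_def by (intro integral_test_le_ball_average[OF tv \<open>0 \<le> c\<close> r(1) _ _ S(1) _ Sr]) auto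
    qed
    also have "\<dots> < e"
      using cr elim by linarith
    finally have "(\<integral>x. indicator K x * \<bar>rep_L2 (w k) x\<bar> \<partial>lborel) < e" .
    moreover have "0 \<le> (\<integral>x. indicator K x * \<bar>rep_L2 (w k) x\<bar> \<partial>lborel)"
      by (intro Bochner_Integration.integral_nonneg) simp
    ultimately show ?case
      by simp
  qed
qed

text \<open>The \<open>L\<^sup>2\<close> bound keeps mass from concentrating at the boundary of \<open>\<Omega>\<close>.\<close>

lemma L1_tendsto_zero:
  fixes w :: "nat \<Rightarrow> 'a::euclidean_space L2"
  assumes "open \<Omega>" "bounded \<Omega>" and weak: "weakly_tendsto w 0" and B: "\<And>k. norm (w k) \<le> B"
    and tv: "\<And>k. total_variation \<Omega> (rep_L2 (w k)) \<le> ereal c"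
  shows "(\<lambda>k. \<integral>x. indicator \<Omega> x * \<bar>rep_L2 (w k) x\<bar> \<partial>lborel) \<longlonglongrightarrow> 0"
proof (rule tendstoI)
  fix e :: real assume "0 < e"
  have "0 \<le> B"
    using order_trans[OF norm_ge_zero B] by blast
  \<comment> \<open>\<open>d\<^sup>2\<close> will bound the measure of \<open>\<Omega> - K\<close>,
    so that by Cauchy-Schwarz the mass there is at most \<open>d * B\<close>, hence at most
    \<open>e / 2\<close>.\<close>
  define d where "d = e / (2 * (B + 1))"
  have "0 < d" using \<open>0 < e\<close> \<open>0 \<le> B\<close> by (simp add: d_def)
  have \<Omega>: "\<Omega> \<in> sets borel" "emeasure lborel \<Omega> < \<infinity>"
    using \<open>open \<Omega>\<close> emeasure_bounded_finite[OF \<open>bounded \<Omega>\<close>] by auto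
  have "\<Omega> \<in> sets lebesgue" using \<Omega> by simp
  then obtain K where K: "closed K" "K \<subseteq> \<Omega>" "emeasure lebesgue (\<Omega> - K) < ennreal (d\<^sup>2)"
    using \<open>0 < d\<close> by (elim sets_lebesgue_inner_closed[where e = "d\<^sup>2"]) auto
  have "compact K"
    using K \<open>bounded \<Omega>\<close> by (auto simp: compact_eq_bounded_closed intro: bounded_subset)
  have D: "\<Omega> - K \<in> sets borel" using \<Omega> K(1) by auto
  have em: "emeasure lborel (\<Omega> - K) < ennreal (d\<^sup>2)"
    using K(3) D by simp
  then have D_fin: "emeasure lborel (\<Omega> - K) < \<infinity>"
    by (rule order.strict_trans) simp
  have "measure lborel (\<Omega> - K) \<le> d\<^sup>2"
    using em by (simp add: measure_def enn2real_leI)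
  then have sq: "norm (abs_L2 (indicator (\<Omega> - K))) \<le> d"
    unfolding norm_abs_L2_indicator[OF D D_fin] using \<open>0 < d\<close> by (simp add: real_le_lsqrt)
  have "\<forall>\<^sub>F k in sequentially. dist (\<integral>x. indicator K x * \<bar>rep_L2 (w k) x\<bar> \<partial>lborel) 0 < e / 2"
    using L1_tendsto_zero_on_compact[OF \<open>open \<Omega>\<close> weak B tv \<open>compact K\<close> K(2)] \<open>0 < e\<close>
    by (intro tendstoD) auto
  then show "\<forall>\<^sub>F k in sequentially. dist (\<integral>x. indicator \<Omega> x * \<bar>rep_L2 (w k) x\<bar> \<partial>lborel) 0 < e"
  proof eventually_elim
    case (elim k)
    have K_fin: "emeasure lborel K < \<infinity>"
      by (rule emeasure_compact_finite[OF \<open>compact K\<close>])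
    have int: "integrable lborel (\<lambda>x. indicator X x * \<bar>rep_L2 (w k) x\<bar>)"
      if "X \<in> sets borel" "emeasure lborel X < \<infinity>" for X
      by (intro square_integrable_mult square_integrable_indicator that square_integrable_abs
          square_integrable_rep)
    have "(\<integral>x. indicator \<Omega> x * \<bar>rep_L2 (w k) x\<bar> \<partial>lborel)
        = (\<integral>x. indicator K x * \<bar>rep_L2 (w k) x\<bar> + indicator (\<Omega> - K) x * \<bar>rep_L2 (w k) x\<bar> \<partial>lborel)"
      using K(2) by (intro Bochner_Integration.integral_cong) (auto simp: indicator_def)
    also have "\<dots> = (\<integral>x. indicator K x * \<bar>rep_L2 (w k) x\<bar> \<partial>lborel)
        + (\<integral>x. indicator (\<Omega> - K) x * \<bar>rep_L2 (w k) x\<bar> \<partial>lborel)"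
      using K(1) K_fin D D_fin by (intro Bochner_Integration.integral_add int) auto
    also have "(\<integral>x. indicator (\<Omega> - K) x * \<bar>rep_L2 (w k) x\<bar> \<partial>lborel)
        = (\<integral>x. \<bar>indicator (\<Omega> - K) x * rep_L2 (w k) x\<bar> \<partial>lborel)"
      by (simp add: abs_mult)
    also have "\<dots> \<le> norm (abs_L2 (indicator (\<Omega> - K))) * norm (w k)"
      using integral_abs_mult_le[OF square_integrable_indicator[OF D D_fin] square_integrable_rep[of "w k"]]
      by (simp add: abs_rep_L2)
    also have "\<dots> \<le> d * B"
      using sq B \<open>0 < d\<close> by (intro mult_mono) auto
    also have "\<dots> \<le> e / 2"
      using \<open>0 < e\<close> \<open>0 \<le> B\<close> by (simp add: d_def field_simps)
    finally have "(\<integral>x. indicator \<Omega> x * \<bar>rep_L2 (w k) x\<bar> \<partial>lborel)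
        \<le> (\<integral>x. indicator K x * \<bar>rep_L2 (w k) x\<bar> \<partial>lborel) + e / 2"
      by simp
    moreover have "0 \<le> (\<integral>x. indicator \<Omega> x * \<bar>rep_L2 (w k) x\<bar> \<partial>lborel)"
      by (intro Bochner_Integration.integral_nonneg) simp
    ultimately show ?case
      using elim by simp
  qed
qed

section \<open>Gradient measures as extended functionals\<close>

text \<open>Unlike \<^const>\<open>vanishing_fields\<close>, this space of fields is closed under linear combinations at once.\<close>

definition approximable :: "'a::euclidean_space set \<Rightarrow> ('a \<Rightarrow> 'a) \<Rightarrow> bool" where
  "approximable \<Omega> \<phi> \<longleftrightarrow> (\<forall>\<delta>>0. \<exists>\<psi>\<in>test_fields \<Omega>. \<forall>x. norm (\<phi> x - \<psi> x) \<le> \<delta>)"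

lemma approximableE:
  assumes "approximable \<Omega> \<phi>" "0 < \<delta>"
  obtains \<psi> where "\<psi> \<in> test_fields \<Omega>" "\<And>x. norm (\<phi> x - \<psi> x) \<le> \<delta>"
  using assms unfolding approximable_def by blast

lemma vanishing_fields_approximable: "open \<Omega> \<Longrightarrow> \<phi> \<in> vanishing_fields \<Omega> \<Longrightarrow> approximable \<Omega> \<phi>"
  unfolding approximable_def by (metis test_fields_dense)

lemma approximable_add:
  assumes "approximable \<Omega> \<phi>" "approximable \<Omega> \<psi>"
  shows "approximable \<Omega> (\<lambda>x. \<phi> x + \<psi> x)"
  unfolding approximable_def
proof (intro allI impI)
  fix \<delta> :: real assume "0 < \<delta>"
  then have "0 < \<delta> / 2" by simp
  obtain f where f: "f \<in> test_fields \<Omega>" "\<And>x. norm (\<phi> x - f x) \<le> \<delta> / 2"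
    using assms(1) \<open>0 < \<delta> / 2\<close> by (rule approximableE) blast
  obtain g where g: "g \<in> test_fields \<Omega>" "\<And>x. norm (\<psi> x - g x) \<le> \<delta> / 2"
    using assms(2) \<open>0 < \<delta> / 2\<close> by (rule approximableE) blast
  have "norm (\<phi> x + \<psi> x - (f x + g x)) \<le> \<delta>" for x
    using norm_triangle_le[OF add_mono[OF f(2) g(2)]] by (simp add: add_diff_add)
  then show "\<exists>h\<in>test_fields \<Omega>. \<forall>x. norm (\<phi> x + \<psi> x - h x) \<le> \<delta>"
    using test_fields_add[OF f(1) g(1)] by (intro bexI[of _ "\<lambda>x. f x + g x"]) auto
qed

lemma approximable_scaleR:
  assumes "approximable \<Omega> \<phi>"
  shows "approximable \<Omega> (\<lambda>x. c *\<^sub>R \<phi> x)"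
  unfolding approximable_def
proof (intro allI impI)
  fix \<delta> :: real assume "0 < \<delta>"
  then have "0 < \<delta> / (\<bar>c\<bar> + 1)" by (simp add: add_nonneg_pos)
  from approximableE[OF assms this]
  obtain f where f: "f \<in> test_fields \<Omega>" "\<And>x. norm (\<phi> x - f x) \<le> \<delta> / (\<bar>c\<bar> + 1)"
    by blast
  have "norm (c *\<^sub>R \<phi> x - c *\<^sub>R f x) \<le> \<delta>" for x
  proof -
    have "norm (c *\<^sub>R \<phi> x - c *\<^sub>R f x) = \<bar>c\<bar> * norm (\<phi> x - f x)"
      by (simp flip: scaleR_diff_right)
    also have "\<dots> \<le> (\<bar>c\<bar> + 1) * (\<delta> / (\<bar>c\<bar> + 1))"
      by (intro mult_mono f) auto
    finally show ?thesis by simp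
  qed
  then show "\<exists>h\<in>test_fields \<Omega>. \<forall>x. norm (c *\<^sub>R \<phi> x - h x) \<le> \<delta>"
    using test_fields_scaleR[OF f(1)] by (intro bexI[of _ "\<lambda>x. c *\<^sub>R f x"]) auto
qed

text \<open>This single inequality makes \<open>T\<close> the extension of the functional
  \<open>- (u \<bullet> div_L2 \<psi>)\<close> by uniform continuity with constant \<open>c\<close>.
  For \<open>c \<ge> 0\<close>, linearity, boundedness and the values on test fields all follow from
  it.\<close>

definition extends_gradient ::
    "'a::euclidean_space set \<Rightarrow> 'a L2 \<Rightarrow> real \<Rightarrow> (('a \<Rightarrow> 'a) \<Rightarrow> real) \<Rightarrow> bool" where
  "extends_gradient \<Omega> u c T \<longleftrightarrow> (\<forall>\<phi> \<psi> M. approximable \<Omega> \<phi> \<longrightarrow> \<psi> \<in> test_fields \<Omega> \<longrightarrow>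
    (\<forall>x. norm (\<phi> x - \<psi> x) \<le> M) \<longrightarrow> \<bar>T \<phi> + u \<bullet> div_L2 \<psi>\<bar> \<le> c * M)"

text \<open>The intervals of radius \<open>c * M\<close> around the values of the functional at the test fields within
  distance \<open>M\<close> of \<open>\<phi>\<close> intersect pairwise, hence have a common point.\<close>

lemma ex_extends_gradient:
  assumes tv: "total_variation \<Omega> (rep_L2 u) \<le> ereal c"
  shows "\<exists>T. extends_gradient \<Omega> u c T"
proof -
  \<comment> \<open>The left endpoints of these intervals; their supremum is the common
    point.\<close>
  define X where "X \<phi> = {- (u \<bullet> div_L2 \<psi>) - c * M |\<psi> M. \<psi> \<in> test_fields \<Omega> \<and> (\<forall>x. norm (\<phi> x - \<psi> x) \<le> M)}" for \<phi>
  have "extends_gradient \<Omega> u c (\<lambda>\<phi>. Sup (X \<phi>))"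
    unfolding extends_gradient_def
  proof (intro allI impI)
    fix \<phi> \<psi> M
    assume \<psi>: "\<psi> \<in> test_fields \<Omega>" "\<forall>x. norm (\<phi> x - \<psi> x) \<le> M"
    have ub: "y \<le> - (u \<bullet> div_L2 \<psi>) + c * M" if "y \<in> X \<phi>" for y
    proof -
      from that obtain f N where f: "y = - (u \<bullet> div_L2 f) - c * N" "f \<in> test_fields \<Omega>"
        "\<And>x. norm (\<phi> x - f x) \<le> N"
        unfolding X_def by blast
      have "norm (\<psi> x - f x) \<le> M + N" for x
        using norm_triangle_le_diff[of "\<phi> x - f x" "\<phi> x - \<psi> x" "M + N"] \<psi>(2) f(3)[of x]
        by (metis add.commute add_mono diff_diff_eq2 diff_add_cancel add_diff_cancel_right')
      then have "\<bar>u \<bullet> div_L2 (\<lambda>x. \<psi> x - f x)\<bar> \<le> c * (M + N)"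
        by (intro inner_div_L2_le[OF tv] test_fields_diff \<psi> f)
      then show ?thesis
        using f(1) by (simp add: div_L2_diff[OF \<psi>(1) f(2)] inner_diff_right algebra_simps abs_le_iff)
    qed
    have mem: "- (u \<bullet> div_L2 \<psi>) - c * M \<in> X \<phi>"
      using \<psi> unfolding X_def by blast
    have "Sup (X \<phi>) \<le> - (u \<bullet> div_L2 \<psi>) + c * M"
      using mem ub by (intro cSup_least) auto
    moreover have "- (u \<bullet> div_L2 \<psi>) - c * M \<le> Sup (X \<phi>)"
      using mem ub by (intro cSup_upper bdd_aboveI)
    ultimately show "\<bar>Sup (X \<phi>) + u \<bullet> div_L2 \<psi>\<bar> \<le> c * M"
      by (simp add: abs_le_iff)
  qed
  then show ?thesis by blast
qed

lemma extends_gradientD: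
  "extends_gradient \<Omega> u c T \<Longrightarrow> approximable \<Omega> \<phi> \<Longrightarrow> \<psi> \<in> test_fields \<Omega> \<Longrightarrow>
    (\<And>x. norm (\<phi> x - \<psi> x) \<le> M) \<Longrightarrow> \<bar>T \<phi> + u \<bullet> div_L2 \<psi>\<bar> \<le> c * M"
  unfolding extends_gradient_def by blast

lemma eq_if_abs_diff_le_small_multiple:
  fixes a b q :: real
  assumes "0 \<le> q" and "\<And>t. 0 < t \<Longrightarrow> \<bar>a - b\<bar> \<le> t * q"
  shows "a = b"
  using le_zero_if_le_small_multiple[of q "\<bar>a - b\<bar>"] assms by simp

text \<open>Replacing the arguments by test fields within \<open>t\<close> reduces linearity to that
  of \<open>div_L2\<close>, up to an error proportional to \<open>t\<close>. A test field
  approximates itself with error 0, and the zero field gives the bound.\<close>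

lemma extends_gradient_imp_gradient_measure:
  assumes "open \<Omega>" and T: "extends_gradient \<Omega> u c T" and "0 \<le> c"
  shows "is_gradient_measure \<Omega> (rep_L2 u) T"
  unfolding is_gradient_measure_def
proof (intro conjI ballI allI impI)
  fix \<phi> \<psi> assume "\<phi> \<in> vanishing_fields \<Omega>" "\<psi> \<in> vanishing_fields \<Omega>"
  then have ap: "approximable \<Omega> \<phi>" "approximable \<Omega> \<psi>"
    using \<open>open \<Omega>\<close> vanishing_fields_approximable by auto
  show "T (\<lambda>x. \<phi> x + \<psi> x) = T \<phi> + T \<psi>"
  proof (rule eq_if_abs_diff_le_small_multiple[of "4 * c"])
    fix t :: real assume "0 < t"
    obtain f where f: "f \<in> test_fields \<Omega>" "\<And>x. norm (\<phi> x - f x) \<le> t"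
      using ap(1) \<open>0 < t\<close> by (rule approximableE) blast
    obtain g where g: "g \<in> test_fields \<Omega>" "\<And>x. norm (\<psi> x - g x) \<le> t"
      using ap(2) \<open>0 < t\<close> by (rule approximableE) blast
    have "norm (\<phi> x + \<psi> x - (f x + g x)) \<le> t + t" for x
      using norm_triangle_le[OF add_mono[OF f(2) g(2)]] by (simp add: add_diff_add)
    then have "\<bar>T (\<lambda>x. \<phi> x + \<psi> x) + u \<bullet> div_L2 (\<lambda>x. f x + g x)\<bar> \<le> c * (t + t)"
      by (intro extends_gradientD[OF T] approximable_add ap test_fields_add f g)
    moreover have "\<bar>T \<phi> + u \<bullet> div_L2 f\<bar> \<le> c * t" "\<bar>T \<psi> + u \<bullet> div_L2 g\<bar> \<le> c * t"
      by (intro extends_gradientD[OF T] ap f g)+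
    ultimately show "\<bar>T (\<lambda>x. \<phi> x + \<psi> x) - (T \<phi> + T \<psi>)\<bar> \<le> t * (4 * c)"
      by (simp add: div_L2_add[OF f(1) g(1)] inner_add_right algebra_simps abs_le_iff)
  qed (use \<open>0 \<le> c\<close> in simp)
next
  fix a \<phi> assume "\<phi> \<in> vanishing_fields \<Omega>"
  then have ap: "approximable \<Omega> \<phi>"
    using \<open>open \<Omega>\<close> vanishing_fields_approximable by auto
  show "T (\<lambda>x. a *\<^sub>R \<phi> x) = a * T \<phi>"
  proof (rule eq_if_abs_diff_le_small_multiple[of "2 * \<bar>a\<bar> * c"])
    fix t :: real assume "0 < t"
    obtain f where f: "f \<in> test_fields \<Omega>" "\<And>x. norm (\<phi> x - f x) \<le> t"
      using ap(1) \<open>0 < t\<close> by (rule approximableE) blast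
    have "norm (a *\<^sub>R \<phi> x - a *\<^sub>R f x) \<le> \<bar>a\<bar> * t" for x
      using mult_left_mono[OF f(2)[of x], of "\<bar>a\<bar>"] by (simp flip: scaleR_diff_right)
    then have "\<bar>T (\<lambda>x. a *\<^sub>R \<phi> x) + u \<bullet> div_L2 (\<lambda>x. a *\<^sub>R f x)\<bar> \<le> c * (\<bar>a\<bar> * t)"
      by (intro extends_gradientD[OF T] approximable_scaleR ap test_fields_scaleR f)
    moreover have "\<bar>a * (T \<phi> + u \<bullet> div_L2 f)\<bar> \<le> \<bar>a\<bar> * (c * t)"
      unfolding abs_mult by (intro mult_left_mono extends_gradientD[OF T] ap f) simp
    ultimately have "\<bar>T (\<lambda>x. a *\<^sub>R \<phi> x) - a * T \<phi>\<bar> \<le> c * (\<bar>a\<bar> * t) + \<bar>a\<bar> * (c * t)"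
      unfolding div_L2_scaleR[OF f(1)] inner_scaleR_right distrib_left by linarith
    then show "\<bar>T (\<lambda>x. a *\<^sub>R \<phi> x) - a * T \<phi>\<bar> \<le> t * (2 * \<bar>a\<bar> * c)"
      by (simp add: mult_ac)
  qed (use \<open>0 \<le> c\<close> in simp)
next
  show "\<exists>C. \<forall>\<phi>\<in>vanishing_fields \<Omega>. \<forall>M. (\<forall>x. norm (\<phi> x) \<le> M) \<longrightarrow> \<bar>T \<phi>\<bar> \<le> C * M"
  proof (intro exI[of _ c] ballI allI impI)
    fix \<phi> M assume "\<phi> \<in> vanishing_fields \<Omega>" "\<forall>x. norm (\<phi> x) \<le> M"
    then show "\<bar>T \<phi>\<bar> \<le> c * M"
      using extends_gradientD[OF T vanishing_fields_approximable[OF \<open>open \<Omega>\<close>] test_fields_zero, of \<phi> M]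
      by (simp add: div_L2_zero)
  qed
next
  fix \<phi> assume \<phi>: "\<phi> \<in> test_fields \<Omega>"
  then have "approximable \<Omega> \<phi>"
    unfolding approximable_def by (auto intro!: bexI[of _ \<phi>])
  then have "\<bar>T \<phi> + u \<bullet> div_L2 \<phi>\<bar> \<le> c * 0"
    by (intro extends_gradientD[OF T] \<phi>) auto
  then show "T \<phi> = - (LINT x:\<Omega>|lborel. rep_L2 u x * divergence \<phi> x)"
    by (simp add: set_integral_divergence[OF \<phi>])
qed

text \<open>Since \<open>c\<close> is the same for all \<open>k\<close>, replacing
  \<open>\<phi>\<close> by one test field \<open>\<psi>\<close> costs at most
  \<open>c * \<delta>\<close> uniformly; at \<open>\<psi>\<close> weak convergence applies.\<close>

lemma extends_gradient_tendsto:
  assumes weak: "weakly_tendsto u v" and T: "\<And>k. extends_gradient \<Omega> (u k) c (T k)"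
    and S: "extends_gradient \<Omega> v c S" and "0 \<le> c" and \<phi>: "approximable \<Omega> \<phi>"
  shows "(\<lambda>k. T k \<phi>) \<longlonglongrightarrow> S \<phi>"
proof (rule tendstoI)
  fix e :: real assume "0 < e"
  define \<delta> where "\<delta> = e / (4 * (c + 1))"
  have "0 < \<delta>" using \<open>0 < e\<close> \<open>0 \<le> c\<close> by (simp add: \<delta>_def)
  have c\<delta>: "c * \<delta> \<le> e / 4"
    using \<open>0 < e\<close> \<open>0 \<le> c\<close> by (simp add: \<delta>_def field_simps)
  obtain \<psi> where \<psi>: "\<psi> \<in> test_fields \<Omega>" "\<And>x. norm (\<phi> x - \<psi> x) \<le> \<delta>"
    using \<phi> \<open>0 < \<delta>\<close> by (rule approximableE) blast
  have "(\<lambda>k. u k \<bullet> div_L2 \<psi>) \<longlonglongrightarrow> v \<bullet> div_L2 \<psi>"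
    using weak by (simp add: weakly_tendsto_def)
  then have "\<forall>\<^sub>F k in sequentially. dist (u k \<bullet> div_L2 \<psi>) (v \<bullet> div_L2 \<psi>) < e / 2"
    using \<open>0 < e\<close> by (intro tendstoD) auto
  then show "\<forall>\<^sub>F k in sequentially. dist (T k \<phi>) (S \<phi>) < e"
  proof eventually_elim
    case (elim k)
    then show ?case
      using extends_gradientD[OF T[of k] \<phi> \<psi>] extends_gradientD[OF S \<phi> \<psi>] c\<delta>
      unfolding dist_real_def by linarith
  qed
qed

lemma rep_L2_in_BV:
  assumes "open \<Omega>" "bounded \<Omega>" "total_variation \<Omega> (rep_L2 u) \<le> ereal c"
  shows "rep_L2 u \<in> BV \<Omega>"
proof -
  have "square_integrable (indicator \<Omega>)"
    using assms(1) emeasure_bounded_finite[OF assms(2)] by (intro square_integrable_indicator) auto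
  from square_integrable_mult[OF this square_integrable_rep[of u]] show ?thesis
    using assms(3) by (auto simp: BV_def set_integrable_def)
qed

text \<open>The limit inherits the bound \<open>c\<close>, so the differences \<open>u k - v\<close>
  have variation at most \<open>c + c\<close> and tend weakly to 0, which yields the L1 part. The
  gradient functionals are all chosen with the common constant \<open>c\<close>.\<close>

theorem weakly_tendsto_imp_BV_weak_star:
  fixes u :: "nat \<Rightarrow> 'a::euclidean_space L2"
  assumes "open \<Omega>" "bounded \<Omega>" and weak: "weakly_tendsto u v" and B: "\<And>k. norm (u k) \<le> B"
    and tv: "\<And>k. total_variation \<Omega> (rep_L2 (u k)) \<le> ereal c"
  shows "BV_weak_star_tendsto \<Omega> (\<lambda>k. rep_L2 (u k)) (rep_L2 v)"
proof -
  have "0 \<le> c"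
    using order_trans[OF total_variation_nonneg tv] by simp
  have tvv: "total_variation \<Omega> (rep_L2 v) \<le> ereal c"
    by (rule total_variation_le_weak_limit[OF weak tv])
  have "(\<lambda>k. \<integral>x. indicator \<Omega> x * \<bar>rep_L2 (u k - v) x\<bar> \<partial>lborel) \<longlonglongrightarrow> 0"
  proof (rule L1_tendsto_zero[OF assms(1,2)])
    show "weakly_tendsto (\<lambda>k. u k - v) 0"
      using weak by (simp add: weakly_tendsto_def inner_diff_left LIM_zero)
    show "norm (u k - v) \<le> B + norm v" for k
      using norm_triangle_ineq4[of "u k" v] B[of k] by linarith
    show "total_variation \<Omega> (rep_L2 (u k - v)) \<le> ereal (c + c)" for k
      by (rule total_variation_diff_le[OF tv tvv])
  qed
  moreover have "(\<integral>x. indicator \<Omega> x * \<bar>rep_L2 (u k - v) x\<bar> \<partial>lborel)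
      = (LINT x:\<Omega>|lborel. \<bar>rep_L2 (u k) x - rep_L2 v x\<bar>)" for k
    unfolding set_lebesgue_integral_def
  proof (rule integral_cong_AE)
    show "AE x in lborel. indicator \<Omega> x * \<bar>rep_L2 (u k - v) x\<bar>
        = indicator \<Omega> x *\<^sub>R \<bar>rep_L2 (u k) x - rep_L2 v x\<bar>"
      using rep_L2_diff[of "u k" v] by eventually_elim simp
  qed (use assms(1) in \<open>auto intro!: borel_measurable_times borel_measurable_indicator
        borel_measurable_abs borel_measurable_diff\<close>)
  ultimately have L1: "(\<lambda>k. LINT x:\<Omega>|lborel. \<bar>rep_L2 (u k) x - rep_L2 v x\<bar>) \<longlonglongrightarrow> 0"
    by simp
  obtain T where T: "\<And>k. extends_gradient \<Omega> (u k) c (T k)"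
    using ex_extends_gradient[OF tv] by metis
  obtain S where S: "extends_gradient \<Omega> v c S"
    using ex_extends_gradient[OF tvv] by blast
  show ?thesis
    unfolding BV_weak_star_tendsto_def
    by (intro conjI allI exI[of _ T] exI[of _ S] ballI L1 rep_L2_in_BV[OF assms(1,2) tv]
        rep_L2_in_BV[OF assms(1,2) tvv] extends_gradient_imp_gradient_measure[OF assms(1) _ \<open>0 \<le> c\<close>] T S
        extends_gradient_tendsto[OF weak T S \<open>0 \<le> c\<close>] vanishing_fields_approximable[OF assms(1)])
qed

section \<open>The iteration\<close>

text \<open>\<open>hs k\<close> and \<open>hbar\<close> are the values of the penalty at \<open>u k\<close> and \<open>ubar\<close>, \<open>B\<close> and \<open>E\<close> are Bregman
  distances from \<open>u k\<close>, and \<open>a k\<close> is the adjoint applied to the residual.\<close>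

locale iterated_tikhonov =
  fixes F :: "'x::real_inner \<Rightarrow> 'h::real_inner" and F' :: "'x \<Rightarrow> 'x \<Rightarrow>\<^sub>L 'h" and y :: 'h
    and dom :: "'x set" and ubar :: 'x and \<eta> \<rho> \<gamma> \<alpha>bar :: real and \<alpha> :: "nat \<Rightarrow> real"
    and u \<xi> a :: "nat \<Rightarrow> 'x" and hs :: "nat \<Rightarrow> real" and hbar :: real
    and R B E :: "nat \<Rightarrow> real"
  defines "R \<equiv> \<lambda>k. norm (F (u k) - y)"
    and "B \<equiv> \<lambda>k. hbar - hs k - \<xi> k \<bullet> (ubar - u k)"
    and "E \<equiv> \<lambda>k. hs (Suc k) - hs k - \<xi> k \<bullet> (u (Suc k) - u k)"
  assumes u_dom: "\<And>k. u k \<in> dom" and ubar_dom: "ubar \<in> dom" and F_ubar: "F ubar = y"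
    and tangential: "\<And>v w. v \<in> ball ubar \<rho> \<inter> dom \<Longrightarrow> w \<in> ball ubar \<rho> \<inter> dom \<Longrightarrow>
      norm (F w - F v - blinfun_apply (F' v) (w - v)) \<le> \<eta> * norm (v - w) * norm (F v - F w)"
    and \<eta>: "0 < \<eta>" and \<rho>: "0 < \<rho>" and \<gamma>: "0 < \<gamma>" "\<gamma> * \<eta> < 1" "2 * \<gamma> < \<rho>"
    and \<alpha>: "\<And>k. 0 < \<alpha> k" "\<And>k. \<alpha> k < \<alpha>bar"
    and B_ge: "\<And>k. (norm (ubar - u k))\<^sup>2 / 2 \<le> B k"
    and E_ge: "\<And>k. (norm (u (Suc k) - u k))\<^sup>2 / 2 \<le> E k"
    and B_0: "B 0 < \<gamma>\<^sup>2 / 8"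
    and min_ubar: "\<And>k. (R (Suc k))\<^sup>2 / 2 + \<alpha> k * E k \<le> \<alpha> k * B k"
    and min_u: "\<And>k. (R (Suc k))\<^sup>2 / 2 + \<alpha> k * E k \<le> (R k)\<^sup>2 / 2"
    and \<xi>_Suc: "\<And>k. \<xi> (Suc k) = \<xi> k - (1 / \<alpha> k) *\<^sub>R a k"
    and a: "\<And>k x. x \<bullet> a k = blinfun_apply (F' (u (Suc k))) x \<bullet> (F (u (Suc k)) - y)"
begin

text \<open>The origin of the factor 8: half the square of \<open>\<gamma> / 2\<close> is
  \<open>\<gamma>\<^sup>2 / 8\<close>.\<close>

lemma norm_less_of_square:
  assumes "(norm (v::'x))\<^sup>2 / 2 \<le> c" "c < \<gamma>\<^sup>2 / 8"
  shows "norm v < \<gamma> / 2"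
proof -
  have "(norm v)\<^sup>2 < (\<gamma> / 2)\<^sup>2"
    using assms by (simp add: power_divide)
  then show ?thesis
    by (rule power_less_imp_less_base) (use \<gamma>(1) in simp)
qed

lemma E_nonneg: "0 \<le> E k"
  by (rule order_trans[OF _ E_ge]) simp

lemma B_nonneg: "0 \<le> B k"
  by (rule order_trans[OF _ B_ge]) simp

text \<open>\<open>min_u\<close> is minimality against the previous iterate, whose own Bregman term
  is zero.\<close>

lemma R_decreasing: "R (Suc k) \<le> R k"
proof -
  have "(R (Suc k))\<^sup>2 \<le> (R k)\<^sup>2"
    using min_u[of k] mult_nonneg_nonneg[OF less_imp_le[OF \<alpha>(1)] E_nonneg, of k k] by linarith
  then show ?thesis
    unfolding R_def by (rule power2_le_imp_le) (rule norm_ge_zero)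
qed

lemma R_antimono: "j \<le> k \<Longrightarrow> R k \<le> R j"
  using R_decreasing by (rule lift_Suc_antimono_le)

lemma B_step:
  assumes "norm (u (Suc k) - ubar) < \<gamma>"
  shows "B (Suc k) + (1 - \<gamma> * \<eta>) * ((R (Suc k))\<^sup>2 / \<alpha> k) \<le> B k"
proof -
  define w where "w = u (Suc k)"
  \<comment> \<open>The linearization error at \<open>w\<close>; relative to the residual it is at
    most \<open>\<eta> * \<gamma>\<close>, which is below 1.\<close>
  define e where "e = F ubar - F w - blinfun_apply (F' w) (ubar - w)"
  have "w \<in> ball ubar \<rho> \<inter> dom" "ubar \<in> ball ubar \<rho> \<inter> dom"
    using assms \<gamma> u_dom ubar_dom \<rho> by (auto simp: w_def dist_norm norm_minus_commute)
  then have "norm e \<le> \<eta> * norm (w - ubar) * norm (F w - F ubar)"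
    unfolding e_def by (rule tangential)
  also have "\<dots> \<le> \<eta> * \<gamma> * R (Suc k)"
    using assms \<eta> \<gamma>(1) by (intro mult_mono) (auto simp: w_def R_def F_ubar)
  finally have e: "norm e \<le> \<eta> * \<gamma> * R (Suc k)" .
  have "(ubar - w) \<bullet> a k = blinfun_apply (F' w) (ubar - w) \<bullet> (F w - y)"
    unfolding a w_def ..
  also have "\<dots> = - ((F w - y) \<bullet> (F w - y)) - e \<bullet> (F w - y)"
    by (simp add: e_def F_ubar inner_diff_left)
  also have "\<dots> = - (R (Suc k))\<^sup>2 - e \<bullet> (F w - y)"
    by (simp add: R_def w_def power2_norm_eq_inner)
  also have "\<dots> \<le> - (R (Suc k))\<^sup>2 + (\<eta> * \<gamma> * R (Suc k)) * R (Suc k)"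
    using norm_cauchy_schwarz[of "- e" "F w - y"] mult_right_mono[OF e, of "R (Suc k)"]
    by (simp add: R_def w_def)
  finally have *: "(ubar - w) \<bullet> a k \<le> - ((1 - \<gamma> * \<eta>) * (R (Suc k))\<^sup>2)"
    by (simp add: power2_eq_square algebra_simps)
  \<comment> \<open>Three-point identity: the penalty values cancel and only the change of the
    subgradient remains, which the update rule expresses by the adjoint.\<close>
  have "B (Suc k) - B k + E k = (\<xi> k - \<xi> (Suc k)) \<bullet> (ubar - w)"
    by (simp add: B_def E_def w_def algebra_simps)
  also have "\<dots> = (1 / \<alpha> k) * ((ubar - w) \<bullet> a k)"
    by (simp add: \<xi>_Suc inner_commute)
  also have "\<dots> \<le> (1 / \<alpha> k) * - ((1 - \<gamma> * \<eta>) * (R (Suc k))\<^sup>2)"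
    using \<alpha>(1)[of k] by (intro mult_left_mono *) simp
  finally show ?thesis
    using E_nonneg[of k] by simp
qed

text \<open>\<open>min_ubar\<close> yields \<open>E k \<le> B k\<close>, so the step is shorter than
  \<open>\<gamma> / 2\<close> and starts within \<open>\<gamma> / 2\<close> of \<open>ubar\<close>.
  Hence \<open>B_step\<close> applies, and its decrease restores the smaller radius for the next
  round.\<close>

lemma iterates_close: "B k < \<gamma>\<^sup>2 / 8 \<and> norm (u k - ubar) < \<gamma> / 2"
proof (induction k)
  case 0
  show ?case
    using B_0 norm_less_of_square[OF B_ge[of 0]] by (simp add: norm_minus_commute)
next
  case (Suc k)
  have "\<alpha> k * E k \<le> \<alpha> k * B k"
    using min_ubar[of k] zero_le_power2[of "R (Suc k)"] by linarith
  then have "E k \<le> B k"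
    using \<alpha>(1)[of k] by simp
  then have "norm (u (Suc k) - u k) < \<gamma> / 2"
    using Suc by (intro norm_less_of_square[OF E_ge]) auto
  then have "norm (u (Suc k) - ubar) < \<gamma>"
    using Suc norm_triangle_ineq[of "u (Suc k) - u k" "u k - ubar"] by simp
  then have "B (Suc k) + (1 - \<gamma> * \<eta>) * ((R (Suc k))\<^sup>2 / \<alpha> k) \<le> B k"
    by (rule B_step)
  moreover have "0 \<le> (1 - \<gamma> * \<eta>) * ((R (Suc k))\<^sup>2 / \<alpha> k)"
    using \<gamma>(2) \<alpha>(1)[of k] by simp
  ultimately have "B (Suc k) < \<gamma>\<^sup>2 / 8"
    using Suc by linarith
  then show ?case
    using norm_less_of_square[OF B_ge] by (simp add: norm_minus_commute)
qed

lemma norm_iterate_less: "norm (u k - ubar) < \<gamma>"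
  using iterates_close[of k] \<gamma>(1) by linarith

lemma sum_residuals_le:
  "(\<Sum>j<k. (R (Suc j))\<^sup>2 / \<alpha> j) \<le> B 0 / (1 - \<gamma> * \<eta>)"
proof -
  have "(1 - \<gamma> * \<eta>) * (\<Sum>j<k. (R (Suc j))\<^sup>2 / \<alpha> j) \<le> B 0 - B k"
  proof (induction k)
    case (Suc k)
    then show ?case
      using B_step[OF norm_iterate_less, of k] by (simp add: distrib_left)
  qed simp
  also have "\<dots> \<le> B 0"
    using B_nonneg[of k] by simp
  finally show ?thesis
    using \<gamma>(2) by (simp add: pos_le_divide_eq mult.commute)
qed

text \<open>The weights \<open>1 / \<alpha> j\<close> exceed \<open>1 / \<alpha>bar\<close>, so the
  weighted terms dominate the squared residuals up to a constant.\<close>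

lemma residual_tendsto_0: "R \<longlonglongrightarrow> 0"
proof -
  have "summable (\<lambda>j. (R (Suc j))\<^sup>2 / \<alpha> j)"
    by (rule summableI_nonneg_bounded[OF _ sum_residuals_le])
      (intro divide_nonneg_pos zero_le_power2 \<alpha>)
  then have "(\<lambda>j. \<alpha>bar * ((R (Suc j))\<^sup>2 / \<alpha> j)) \<longlonglongrightarrow> 0"
    by (intro tendsto_mult_right_zero summable_LIMSEQ_zero)
  moreover have "norm ((R (Suc j))\<^sup>2) \<le> \<alpha>bar * ((R (Suc j))\<^sup>2 / \<alpha> j)" for j
    using \<alpha>(1,2)[of j] mult_right_mono[of "\<alpha> j" \<alpha>bar "(R (Suc j))\<^sup>2"] by (simp add: pos_le_divide_eq mult.commute)
  ultimately have "(\<lambda>j. (R (Suc j))\<^sup>2) \<longlonglongrightarrow> 0"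
    by (rule Lim_null_comparison[OF always_eventually[OF allI], rotated])
  from tendsto_real_sqrt[OF this] have "(\<lambda>j. sqrt ((R (Suc j))\<^sup>2)) \<longlonglongrightarrow> 0"
    by (simp only: real_sqrt_zero)
  moreover have "sqrt ((R (Suc j))\<^sup>2) = R (Suc j)" for j
    by (simp add: R_def)
  ultimately show ?thesis
    using LIMSEQ_imp_Suc[of R 0] by simp
qed

lemma \<xi>_sum: "\<xi> k = \<xi> 0 - (\<Sum>j<k. (1 / \<alpha> j) *\<^sub>R a j)"
  by (induction k) (simp_all add: \<xi>_Suc)

text \<open>The factor 3 is 1 + 2: two points of the ball are at most \<open>2 * \<gamma>\<close>
  apart, so the cone condition bounds the linearization error by twice the difference of the
  values.\<close>

lemma derivative_le:
  assumes "norm (v - ubar) < \<gamma>" "v \<in> dom" "norm (w - ubar) < \<gamma>" "w \<in> dom"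
  shows "norm (blinfun_apply (F' v) (w - v)) \<le> 3 * norm (F v - F w)"
proof -
  have "norm (F w - F v - blinfun_apply (F' v) (w - v)) \<le> \<eta> * norm (v - w) * norm (F v - F w)"
    using assms \<gamma> by (intro tangential) (auto simp: dist_norm norm_minus_commute)
  also have "\<dots> \<le> 2 * norm (F v - F w)"
  proof (rule mult_right_mono)
    have "norm (v - w) \<le> 2 * \<gamma>"
      using assms norm_triangle_ineq4[of "v - ubar" "w - ubar"] by simp
    then have "\<eta> * norm (v - w) \<le> \<eta> * (2 * \<gamma>)"
      using \<eta> by simp
    then show "\<eta> * norm (v - w) \<le> 2"
      using \<gamma>(2) by (simp add: mult.commute)
  qed simp
  finally show ?thesis
    using norm_triangle_ineq4[of "F w - F v" "F w - F v - blinfun_apply (F' v) (w - v)"]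
    by (simp add: norm_minus_commute)
qed

text \<open>By the monotonicity of the residuals, \<open>F' (u (Suc j))\<close> maps \<open>u k - ubar\<close> to something of the
  order of the \<open>j\<close>-th residual, so that the summability of the squared residuals controls \<open>\<xi> k\<close>.\<close>

lemma penalty_bounded:
  "hs k \<le> hbar + norm (\<xi> 0) * \<gamma> + 9 * (B 0 / (1 - \<gamma> * \<eta>))"
proof -
  \<comment> \<open>The factor 9 is 6 + 3: the part from \<open>u (Suc j)\<close> to
    \<open>u k\<close> costs three times two residuals, each at most \<open>R (Suc j)\<close>, and
    the part from \<open>u (Suc j)\<close> to \<open>ubar\<close> three times one.\<close>
  have term_le: "- ((1 / \<alpha> j) * ((u k - ubar) \<bullet> a j)) \<le> 9 * ((R (Suc j))\<^sup>2 / \<alpha> j)" if "j < k" for j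
  proof -
    define w where "w = u (Suc j)"
    have w: "norm (w - ubar) < \<gamma>" "w \<in> dom"
      by (simp_all add: w_def norm_iterate_less u_dom)
    have "norm (blinfun_apply (F' w) (u k - w)) \<le> 3 * norm (F w - F (u k))"
      by (intro derivative_le w norm_iterate_less u_dom)
    moreover have "norm (F w - F (u k)) \<le> R (Suc j) + R k"
      using norm_triangle_ineq4[of "F w - y" "F (u k) - y"] by (simp add: R_def w_def)
    moreover have "R k \<le> R (Suc j)"
      using that by (intro R_antimono) simp
    moreover have "norm (blinfun_apply (F' w) (ubar - w)) \<le> 3 * norm (F w - F ubar)"
      using \<gamma>(1) ubar_dom by (intro derivative_le w) auto
    then have "norm (blinfun_apply (F' w) (ubar - w)) \<le> 3 * R (Suc j)"
      by (simp add: R_def w_def F_ubar)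
    moreover have "blinfun_apply (F' w) (u k - ubar)
        = blinfun_apply (F' w) (u k - w) - blinfun_apply (F' w) (ubar - w)"
      by (simp add: blinfun.diff_right)
    ultimately have "norm (blinfun_apply (F' w) (u k - ubar)) \<le> 9 * R (Suc j)"
      using norm_triangle_ineq4[of "blinfun_apply (F' w) (u k - w)" "blinfun_apply (F' w) (ubar - w)"]
      by simp
    then have "norm (blinfun_apply (F' w) (u k - ubar)) * R (Suc j) \<le> 9 * R (Suc j) * R (Suc j)"
      by (rule mult_right_mono) (simp add: R_def)
    then have "- ((u k - ubar) \<bullet> a j) \<le> 9 * (R (Suc j))\<^sup>2"
      using norm_cauchy_schwarz[of "- blinfun_apply (F' w) (u k - ubar)" "F w - y"]
      by (simp add: a w_def R_def power2_eq_square)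
    then have "(1 / \<alpha> j) * - ((u k - ubar) \<bullet> a j) \<le> (1 / \<alpha> j) * (9 * (R (Suc j))\<^sup>2)"
      using \<alpha>(1)[of j] by (intro mult_left_mono) auto
    then show ?thesis
      by simp
  qed
  \<comment> \<open>The definition of \<open>B\<close> solved for \<open>hs k\<close>. The norm of
    \<open>\<xi> k\<close> is uncontrolled, so its pairing is expanded along the iteration and
    bounded term by term.\<close>
  have "hs k = hbar - B k + \<xi> k \<bullet> (u k - ubar)"
    by (simp add: B_def inner_diff_right)
  also have "\<xi> k \<bullet> (u k - ubar) = \<xi> 0 \<bullet> (u k - ubar) + (\<Sum>j<k. - ((1 / \<alpha> j) * ((u k - ubar) \<bullet> a j)))"
  proof -
    have "\<xi> k \<bullet> z = \<xi> 0 \<bullet> z + (\<Sum>j<k. - ((1 / \<alpha> j) * (z \<bullet> a j)))" for z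
      unfolding \<xi>_sum[of k] by (simp add: inner_diff_left inner_sum_left sum_negf inner_commute[of z])
    then show ?thesis .
  qed
  also have "(\<Sum>j<k. - ((1 / \<alpha> j) * ((u k - ubar) \<bullet> a j))) \<le> (\<Sum>j<k. 9 * ((R (Suc j))\<^sup>2 / \<alpha> j))"
    by (intro sum_mono term_le) simp
  also have "\<dots> = 9 * (\<Sum>j<k. (R (Suc j))\<^sup>2 / \<alpha> j)"
    by (rule sum_distrib_left[symmetric])
  also have "\<dots> \<le> 9 * (B 0 / (1 - \<gamma> * \<eta>))"
    by (intro mult_left_mono sum_residuals_le) simp
  also have "\<xi> 0 \<bullet> (u k - ubar) \<le> norm (\<xi> 0) * \<gamma>"
    using norm_cauchy_schwarz[of "\<xi> 0" "u k - ubar"]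
      mult_left_mono[OF less_imp_le[OF norm_iterate_less[of k]], of "norm (\<xi> 0)"] by simp
  finally show ?thesis
    using B_nonneg[of k] by simp
qed

end

theorem theorem4p8:
  fixes \<Omega> :: "(real ^ 'n) set"
    and D :: "(real ^ 'n) L2 set"
    and F :: "(real ^ 'n) L2 \<Rightarrow> 'h::{real_inner, complete_space}"
    and F' :: "(real ^ 'n) L2 \<Rightarrow> (real ^ 'n) L2 \<Rightarrow>\<^sub>L 'h"
    and y :: 'h
    and ubar :: "(real ^ 'n) L2"
    and \<eta> \<rho> \<gamma> \<alpha>bar :: real
    and \<alpha> :: "nat \<Rightarrow> real"
    and u \<xi> :: "nat \<Rightarrow> (real ^ 'n) L2"
  assumes "bounded \<Omega>" and "lipschitz_domain \<Omega>"
    and "D \<subseteq> L2_on \<Omega>" and "closed D" and "convex D"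
    and "\<And>v. v \<in> D \<Longrightarrow> (F has_derivative blinfun_apply (F' v)) (at v within D)"
    and "\<And>v. v \<in> D \<Longrightarrow> lives_on \<Omega> (F' v)"
    and "ubar \<in> solutions D F y \<inter> effective_domain (L2_on \<Omega>) (penalty \<Omega>)"
    and "assumption_B D F F' ubar \<eta> \<rho>"
    and "0 < \<gamma>" and "\<gamma> < min (1 / \<eta>) (\<rho> / 2)"
    and "\<And>k. 0 < \<alpha> k" and "\<And>k. \<alpha> k < \<alpha>bar"
    and "u 0 \<in> D \<inter> effective_domain (L2_on \<Omega>) (penalty \<Omega>)"
    and "bregman (penalty \<Omega>) (\<xi> 0) ubar (u 0) < ereal (\<gamma>\<^sup>2 / 8)"
    and "\<And>k. \<xi> k \<in> subdifferential (L2_on \<Omega>) (penalty \<Omega>) (u k)"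
    and "\<And>k. is_arg_min
           (\<lambda>v. ereal ((norm (F v - y))\<^sup>2 / 2) + ereal (\<alpha> k) * bregman (penalty \<Omega>) (\<xi> k) v (u k))
           (\<lambda>v. v \<in> D) (u (Suc k))"
    and "\<And>k. \<xi> (Suc k) =
           \<xi> k - (1 / \<alpha> k) *\<^sub>R adjoint (blinfun_apply (F' (u (Suc k)))) (F (u (Suc k)) - y)"
  shows "(\<exists>v\<in>solutions D F y. \<exists>r. strict_mono r \<and>
            BV_weak_star_tendsto \<Omega> (\<lambda>k. rep_L2 (u (r k))) (rep_L2 v)) \<and>
         (solutions D F y \<inter> closure (ball ubar \<rho>) = {ubar} \<longrightarrow>
            BV_weak_star_tendsto \<Omega> (\<lambda>k. rep_L2 (u k)) (rep_L2 ubar))"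
proof -
  have "open \<Omega>"
    using assms(2) by (simp add: lipschitz_domain_def)
  have uD: "u k \<in> D" for k
    using assms(14,17) by (cases k) (auto simp: is_arg_min_def)
  have ubar: "ubar \<in> D" "F ubar = y" "ubar \<in> L2_on \<Omega>" "penalty \<Omega> ubar < \<infinity>"
    using assms(8) by (auto simp: solutions_def effective_domain_def)
  obtain hbar where hbar: "penalty \<Omega> ubar = ereal hbar"
    using ubar(4) by (rule penalty_finiteE) blast
  \<comment> \<open>A subgradient exists only at points of the effective domain, so every iterate
    has finite penalty.\<close>
  have uL: "u k \<in> L2_on \<Omega>" and u_fin: "penalty \<Omega> (u k) < \<infinity>" for k
    using assms(16)[of k] by (auto simp: subdifferential_def effective_domain_def)
  have "\<exists>h. penalty \<Omega> (u k) = ereal h \<and> total_variation \<Omega> (rep_L2 (u k)) \<le> ereal h" for k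
    using u_fin[of k] by (rule penalty_finiteE) auto
  then obtain hs where hs: "\<And>k. penalty \<Omega> (u k) = ereal (hs k)"
    and tv: "\<And>k. total_variation \<Omega> (rep_L2 (u k)) \<le> ereal (hs k)"
    by metis
  \<comment> \<open>\<open>is_arg_min\<close> only says that no competitor has a smaller extended
    real value; for finite penalties this becomes an inequality between reals.\<close>
  have min: "(norm (F (u (Suc k)) - y))\<^sup>2 / 2 + \<alpha> k * (hs (Suc k) - hs k - \<xi> k \<bullet> (u (Suc k) - u k))
      \<le> (norm (F v - y))\<^sup>2 / 2 + \<alpha> k * (hv - hs k - \<xi> k \<bullet> (v - u k))"
    if "v \<in> D" "penalty \<Omega> v = ereal hv" for k v hv
    using assms(17)[of k] that by (auto simp: is_arg_min_def bregman_def hs not_less)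
  interpret iterated_tikhonov F F' y D ubar \<eta> \<rho> \<gamma> \<alpha>bar \<alpha> u \<xi>
    "\<lambda>k. adjoint (blinfun_apply (F' (u (Suc k)))) (F (u (Suc k)) - y)" hs hbar
    "\<lambda>k. norm (F (u k) - y)" "\<lambda>k. hbar - hs k - \<xi> k \<bullet> (ubar - u k)"
    "\<lambda>k. hs (Suc k) - hs k - \<xi> k \<bullet> (u (Suc k) - u k)"
  proof (unfold_locales, goal_cases)
    case (4 v w)
    then show ?case
      using assms(9) by (simp add: assumption_B_def)
  next
    case 8
    then show ?case
      using assms(9,11) by (simp add: assumption_B_def pos_less_divide_eq)
  next
    case (12 k)
    show ?case
      by (rule bregman_ge_square[OF assms(16) ubar(3) hbar hs])
  next
    case (13 k)
    show ?case
      by (rule bregman_ge_square[OF assms(16) uL hs hs])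
  next
    case 14
    show ?case
      using assms(15) by (simp add: bregman_def hbar hs)
  next
    case (15 k)
    show ?case
      using min[OF ubar(1) hbar, of k] by (simp add: ubar(2))
  next
    \<comment> \<open>The competitor is \<open>u k\<close> itself, at which the Bregman distance
      vanishes.\<close>
    case (16 k)
    show ?case
      using min[OF uD hs, of k k] by simp
  next
    case (17 k)
    show ?case
      by (rule assms(18))
  next
    case (18 k x)
    show ?case
      by (rule adjoint_inner[symmetric])
  qed (use assms(9-13) uD ubar in \<open>auto simp: assumption_B_def\<close>)
  \<comment> \<open>The bound from \<open>penalty_bounded\<close>; the quadratic part of the penalty
    being nonnegative, it also bounds the total variation.\<close>
  define c where "c = hbar + norm (\<xi> 0) * \<gamma> + 9 * ((hbar - hs 0 - \<xi> 0 \<bullet> (ubar - u 0)) / (1 - \<gamma> * \<eta>))"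
  have tv_c: "total_variation \<Omega> (rep_L2 (u k)) \<le> ereal c" for k
    using order_trans[OF tv[of k]] penalty_bounded[of k] by (simp add: c_def)
  have norm_u: "norm (u k) \<le> \<gamma> + norm ubar" for k
    using norm_iterate_less[of k] norm_triangle_sub[of "u k" ubar] by simp
  have F_lim: "(\<lambda>k. F (u k)) \<longlonglongrightarrow> y"
    using residual_tendsto_0 by (simp add: tendsto_norm_zero_iff LIM_zero_iff)
  have closed: "weakly_sequentially_closed D F"
    using assms(9) by (simp add: assumption_B_def)
  have limit: "v \<in> solutions D F y" "norm (v - ubar) \<le> \<gamma>"
    if "strict_mono r" "weakly_tendsto (\<lambda>k. u (r k)) v" for r v
  proof -
    have "weakly_tendsto (\<lambda>k. F (u (r k))) y"
      using LIMSEQ_subseq_LIMSEQ[OF F_lim that(1)]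
      by (intro tendsto_imp_weakly_tendsto) (simp add: o_def)
    then show "v \<in> solutions D F y"
      using closed[unfolded weakly_sequentially_closed_def, rule_format, of "\<lambda>k. u (r k)" v y] uD that(2)
      by (simp add: solutions_def)
    show "norm (v - ubar) \<le> \<gamma>"
      by (rule weakly_tendsto_norm_le[OF that(2)]) (rule less_imp_le[OF norm_iterate_less])
  qed
  have "\<exists>v\<in>solutions D F y. \<exists>r. strict_mono r \<and>
      BV_weak_star_tendsto \<Omega> (\<lambda>k. rep_L2 (u (r k))) (rep_L2 v)"
  proof -
    obtain v r where vr: "strict_mono r" "weakly_tendsto (\<lambda>k. u (r k)) v"
      by (rule weak_sequential_compactness[of u, OF norm_u])
    then have "BV_weak_star_tendsto \<Omega> (\<lambda>k. rep_L2 (u (r k))) (rep_L2 v)"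
      using norm_u tv_c by (intro weakly_tendsto_imp_BV_weak_star[OF \<open>open \<Omega>\<close> assms(1)])
    with vr limit(1) show ?thesis
      by blast
  qed
  moreover have "BV_weak_star_tendsto \<Omega> (\<lambda>k. rep_L2 (u k)) (rep_L2 ubar)"
    if uniq: "solutions D F y \<inter> closure (ball ubar \<rho>) = {ubar}"
  proof (rule weakly_tendsto_imp_BV_weak_star[of \<Omega> u, OF \<open>open \<Omega>\<close> assms(1) _ norm_u tv_c])
    show "weakly_tendsto u ubar"
    proof (rule weakly_tendsto_if_unique_cluster[of u, OF norm_u])
      fix r w assume rw: "strict_mono r" "weakly_tendsto (\<lambda>k. u (r k)) w"
      \<comment> \<open>Weak cluster points stay within \<open>\<gamma>\<close> of
        \<open>ubar\<close>, well inside the ball where \<open>ubar\<close> is the only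
        solution.\<close>
      have "norm (w - ubar) < \<rho>"
        using limit(2)[OF rw] \<gamma> by linarith
      then have "w \<in> closure (ball ubar \<rho>)"
        using closure_subset[of "ball ubar \<rho>"] by (auto simp: dist_norm norm_minus_commute)
      with limit(1)[OF rw] uniq show "w = ubar"
        by blast
    qed
  qed
  ultimately show ?thesis
    by blast
qed

end
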